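(* Let $G(n)$ be the power series coefficients defined by $$\sum_{n\geq 0} G(n) q^n=\sum_{k,n\geq 0} \frac{(q^{2n+2};q^2)_k}{(q^{2n+1};q^2)_k}\,q^{2k+5n+2}.$$ Then $\sum_{n\ge 0}G(n)q^n\succeq 0$, i.e. $G(n)\geq 0$ for every nonnegative integer $n$.
   Context: Notation: $q$ is a complex number with $|q|<1$; $(a;q)_0=1$, $(a;q)_n=\prod_{j=0}^{n-1}(1-aq^j)$ (and the same with $q$ replaced by $q^2$). The double sum runs over all nonnegative integers $k,n$. A power series $\sum_{n\ge0}a_nq^n$ is written $\succeq 0$ if $a_n\ge 0$ for all $n\ge 0$. *)

theory Defs
  imports "HOL-Complex_Analysis.Complex_Analysis"
begin

definition qpochhammer :: "'a::comm_ring_1 \<Rightarrow> 'a \<Rightarrow> nat \<Rightarrow> 'a" where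
  "qpochhammer a q n = (\<Prod>j<n. 1 - a * q ^ j)"

definition G_term :: "complex \<Rightarrow> nat \<Rightarrow> nat \<Rightarrow> complex" where
  "G_term q k n =
     qpochhammer (q ^ (2*n+2)) (q\<^sup>2) k / qpochhammer (q ^ (2*n+1)) (q\<^sup>2) k * q ^ (2*k+5*n+2)"

text \<open>
  The sum over all pairs \<open>(k, n)\<close> is unconditional. By \<open>G_term_summable\<close> below it converges
  absolutely on the open unit disc, so there \<open>infsum\<close> does not take its default value, and by
  \<open>G_fun_power_series\<close> it has a power series expansion on the whole disc.
\<close>
definition G_fun :: "complex \<Rightarrow> complex" where
  "G_fun q = (\<Sum>\<^sub>\<infinity>(k, n)\<in>UNIV. G_term q k n)"

lemma one_minus_power_Suc_nonzero:
  fixes q :: complex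
  assumes "norm q < 1"
  shows "1 - q ^ Suc m \<noteq> 0"
proof
  assume "1 - q ^ Suc m = 0"
  then have "norm q ^ Suc m = 1"
    by (metis eq_iff_diff_eq_0 norm_one norm_power)
  moreover have "norm q ^ Suc m < 1"
    using assms power_less_one_iff[of "norm q" "Suc m"] by simp
  ultimately show False by simp
qed

lemma G_term_eq:
  "G_term q k n = (\<Prod>j<k. (1 - q ^ (2*(n+j)+2)) / (1 - q ^ (2*(n+j)+1))) * q ^ (2*k+5*n+2)"
proof -
  have "q ^ (2*n+2) * (q\<^sup>2) ^ j = q ^ (2*(n+j)+2)" "q ^ (2*n+1) * (q\<^sup>2) ^ j = q ^ (2*(n+j)+1)" for j
    by (simp_all add: power_add algebra_simps flip: power_mult)
  then show ?thesis
    by (simp only: G_term_def qpochhammer_def prod_dividef)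
qed

lemma G_term_bound:
  assumes "norm q \<le> r" "r < 1"
  shows "norm (G_term q k n) \<le> exp (2 / (1 - r)\<^sup>2) * (r ^ k * r ^ n)"
proof -
  have r: "0 \<le> r" using assms(1) norm_ge_zero order_trans by blast
  have factor: "norm ((1 - q ^ (2*m+2)) / (1 - q ^ (2*m+1))) \<le> exp (2 / (1 - r) * r ^ m)" for m
  proof -
    have "norm q ^ i \<le> r ^ m" if "m \<le> i" for i
      using power_mono[OF assms(1), of i] power_decreasing[OF that, of r] assms r by force
    from this[of "2*m+1"] this[of "2*m+2"]
    have a: "norm (q ^ (2*m+1)) \<le> r ^ m" "norm (q ^ (2*m+2)) \<le> r ^ m"
      by (simp_all only: norm_power)
    have "norm q ^ (2*m+1) \<le> r"
      using power_mono[OF assms(1), of "2*m+1"] power_decreasing[of 1 "2*m+1" r] assms r by force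
    then have "1 - r \<le> norm (1 - q ^ (2*m+1))"
      using norm_triangle_ineq2[of 1 "q ^ (2*m+1)"] by (simp only: norm_power norm_one)
    moreover have "norm (q ^ (2*m+1) - q ^ (2*m+2)) \<le> 2 * r ^ m"
      using norm_triangle_ineq4[of "q ^ (2*m+1)" "q ^ (2*m+2)"] a by linarith
    ultimately have b: "norm ((q ^ (2*m+1) - q ^ (2*m+2)) / (1 - q ^ (2*m+1))) \<le> 2 * r ^ m / (1 - r)"
      unfolding norm_divide using assms r by (intro frac_le) auto
    have "norm q < 1" using assms by simp
    then have "1 - q ^ (2*m+1) \<noteq> 0" using one_minus_power_Suc_nonzero[of q "2*m"] by simp
    then have "(1 - q ^ (2*m+2)) / (1 - q ^ (2*m+1))
        = 1 + (q ^ (2*m+1) - q ^ (2*m+2)) / (1 - q ^ (2*m+1))"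
      by (simp add: divide_simps)
    then have "norm ((1 - q ^ (2*m+2)) / (1 - q ^ (2*m+1))) \<le> 1 + 2 * r ^ m / (1 - r)"
      using b norm_triangle_ineq[of 1 "(q ^ (2*m+1) - q ^ (2*m+2)) / (1 - q ^ (2*m+1))"]
      by (simp only: norm_one)
    also have "\<dots> \<le> exp (2 * r ^ m / (1 - r))" by (rule exp_ge_add_one_self)
    finally show ?thesis by simp
  qed
  have geom: "(\<Sum>j<k. r ^ (n+j)) \<le> 1 / (1 - r)"
  proof -
    have "(\<Sum>j<k. r ^ (n+j)) \<le> (\<Sum>j<k. r ^ j)"
      using assms r by (intro sum_mono power_decreasing) auto
    also have "\<dots> \<le> (\<Sum>j. r ^ j)"
      using assms r by (intro sum_le_suminf summable_geometric) auto
    also have "\<dots> = 1 / (1 - r)" using assms r by (simp add: suminf_geometric)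
    finally show ?thesis .
  qed
  have "norm (\<Prod>j<k. (1 - q ^ (2*(n+j)+2)) / (1 - q ^ (2*(n+j)+1)))
      \<le> (\<Prod>j<k. exp (2 / (1 - r) * r ^ (n+j)))"
    unfolding prod_norm[symmetric] by (intro prod_mono conjI norm_ge_zero factor)
  also have "\<dots> = exp (2 / (1 - r) * (\<Sum>j<k. r ^ (n+j)))"
    by (simp add: exp_sum sum_distrib_left)
  also have "\<dots> \<le> exp (2 / (1 - r) * (1 / (1 - r)))"
    using geom assms r by (intro exp_le_cancel_iff[THEN iffD2] mult_left_mono) auto
  also have "\<dots> = exp (2 / (1 - r)\<^sup>2)" by (simp add: power2_eq_square)
  finally have P: "norm (\<Prod>j<k. (1 - q ^ (2*(n+j)+2)) / (1 - q ^ (2*(n+j)+1))) \<le> exp (2 / (1 - r)\<^sup>2)" .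
  have "norm q ^ (2*k+5*n+2) \<le> r ^ (k + n)"
    using power_mono[OF assms(1), of "2*k+5*n+2"] power_decreasing[of "k+n" "2*k+5*n+2" r] assms r
    by force
  then show ?thesis
    unfolding G_term_eq norm_mult norm_power power_add[symmetric]
    using P by (intro mult_mono) auto
qed

lemma geometric_pairs_summable:
  fixes r c :: real
  assumes "0 \<le> r" "r < 1"
  shows "(\<lambda>(k, n). c * (r ^ k * r ^ n)) summable_on (UNIV :: (nat \<times> nat) set)"
proof -
  have s: "((^) r) summable_on (UNIV :: nat set)"
    using assms by (intro norm_summable_imp_summable_on) (simp add: norm_power summable_geometric)
  have "(\<lambda>(k, n). r ^ k * r ^ n) summable_on (UNIV \<times> UNIV :: (nat \<times> nat) set)"
    using s by (intro summable_on_SigmaI[where g = "\<lambda>k. r ^ k * infsum ((^) r) UNIV"])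
      (use assms in \<open>auto intro!: has_sum_cmult_right summable_on_cmult_left\<close>)
  then show ?thesis
    using summable_on_cmult_right[of "\<lambda>(k, n). r ^ k * r ^ n" UNIV c]
    by (simp add: case_prod_unfold)
qed

lemma G_term_summable:
  assumes "norm q < 1"
  shows "(\<lambda>(k, n). norm (G_term q k n)) summable_on UNIV"
  by (rule summable_on_comparison_test[OF geometric_pairs_summable[of "norm q" "exp (2 / (1 - norm q)\<^sup>2)"]])
    (use assms G_term_bound[of q "norm q"] in auto)

lemma G_fun_holomorphic: "G_fun holomorphic_on ball 0 1"
proof -
  have hol: "G_fun holomorphic_on ball 0 r" if r: "0 < r" "r < 1" for r
  proof -
    have lim: "uniform_limit (cball 0 r) (\<lambda>X q. \<Sum>(k, n)\<in>X. G_term q k n) G_fun (finite_subsets_at_top UNIV)"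
      using Weierstrass_m_test_general[of UNIV "cball 0 r" "\<lambda>(k, n) q. G_term q k n"
          "\<lambda>(k, n). exp (2 / (1 - r)\<^sup>2) * (r ^ k * r ^ n)"]
        geometric_pairs_summable[of r] G_term_bound[of _ r] r
      by (simp add: G_fun_def[abs_def] case_prod_unfold)
    have "(\<lambda>q. \<Sum>(k, n)\<in>X. G_term q k n) holomorphic_on cball 0 r" for X
      unfolding G_term_eq case_prod_unfold
      using one_minus_power_Suc_nonzero r
      by (intro holomorphic_intros) (auto simp del: power_Suc)
    then have "\<forall>\<^sub>F X in finite_subsets_at_top UNIV.
        continuous_on (cball 0 r) (\<lambda>q. \<Sum>(k, n)\<in>X. G_term q k n) \<and>
        (\<lambda>q. \<Sum>(k, n)\<in>X. G_term q k n) holomorphic_on ball 0 r"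
      using holomorphic_on_imp_continuous_on holomorphic_on_subset[OF _ ball_subset_cball]
      by (intro always_eventually allI conjI) blast+
    from holomorphic_uniform_limit[OF this lim finite_subsets_at_top_neq_bot]
    show ?thesis by blast
  qed
  have "G_fun holomorphic_on (\<Union>r\<in>{0<..<1}. ball 0 r)"
    by (rule holomorphic_on_UN_open) (use hol in auto)
  moreover have "(\<Union>r\<in>{0<..<1}. ball 0 r) = (ball 0 1 :: complex set)"
  proof (intro equalityI subsetI)
    fix z :: complex assume "z \<in> ball 0 1"
    then obtain r where "norm z < r" "r < 1" using dense[of "norm z" 1] by auto
    moreover from this have "0 < r" using norm_ge_zero le_less_trans by blast
    ultimately show "z \<in> (\<Union>r\<in>{0<..<1}. ball 0 r)" by auto
  qed auto
  ultimately show ?thesis by simp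
qed

lemma G_fun_power_series:
  "\<exists>G :: nat \<Rightarrow> complex. \<forall>q. norm q < 1 \<longrightarrow> (\<lambda>n. G n * q ^ n) sums G_fun q"
  using holomorphic_power_series[OF G_fun_holomorphic]
  by (intro exI[of _ "\<lambda>n. (deriv ^^ n) G_fun 0 / fact n"]) auto

end

theory Submission
  imports Defs
begin

text \<open>
  Write \<open>P\<^sub>n = (q\<^sup>2;q\<^sup>2)\<^sub>n / (q;q\<^sup>2)\<^sub>n\<close>, so that the summand of the double series is
  \<open>P\<^sub>n\<^sub>+\<^sub>k / P\<^sub>n \<cdot> q^(2k+5n+2)\<close>. For fixed \<open>n\<close> the sum over \<open>k\<close> telescopes (\<open>G_term_row_sums\<close>), which
  leaves the single series \<open>\<Sum> q^(3n) / P\<^sub>n\<close> and two geometric series. The single series is a case of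
  the \<open>q\<close>-binomial theorem and equals \<open>P / (1 + q)\<close> with \<open>P = lim P\<^sub>n\<close> (\<open>recip_series_cube\<close>), and by
  an identity of Gauss \<open>P = \<psi>(q) = \<Sum> q^(s(s+1)/2)\<close> (\<open>theta_sums\<close>, from a finite identity of Shanks).
  The generating function of \<open>G\<close> is therefore

    \<open>q\<^sup>3 \<psi>(q)\<^sup>2 / ((1 + q)(1 - q\<^sup>3)) - q\<^sup>3 / (1 - q\<^sup>3)\<^sup>2 + q\<^sup>2 / ((1 - q\<^sup>3)(1 - q\<^sup>5))\<close>.

  The coefficients of \<open>1 / ((1 + q)(1 - q\<^sup>3))\<close> have period 6, namely \<open>1, -1, 1, 0, 0, 0\<close>. So \<open>G (N + 3)\<close>
  is a sum of a periodic weight over the lattice points \<open>(a, b)\<close> with \<open>T\<^sub>a + T\<^sub>b \<le> N\<close>, where \<open>T\<close> denotes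
  triangular numbers, minus \<open>N/3 + 1\<close> if \<open>3\<close> divides \<open>N\<close>, plus the number of representations
  \<open>N + 1 = 3x + 5y\<close>, which is about \<open>N/15\<close>.

  Along a row of constant \<open>a\<close> the weight has period 12 in \<open>b\<close>, because \<open>T\<close> has period 12 modulo 6. Its
  mean over a row is \<open>1/2\<close>, \<open>-1/6\<close>, \<open>1/6\<close> according to the residue 0, 1, 2 of \<open>N - T\<^sub>a\<close> modulo 3, and a
  partial row deviates from its mean by a bounded amount (\<open>row_bound\<close>). The residues of \<open>T\<^sub>a\<close> modulo 3
  are \<open>0, 1, 0\<close> periodically. If \<open>3\<close> divides \<open>N\<close>, all rows have positive mean, and already the
  triangle \<open>a + b \<le> R\<close> with \<open>T\<^sub>R \<le> N\<close> contributes enough to beat \<open>N/3 - N/15\<close>. For the other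
  residues of \<open>N\<close>, apart from row 0, the means in suitable blocks of three consecutive rows add up to
  something nonnegative, since rows get shorter; so the lattice sum is at least \<open>- O(\<surd>N)\<close>, and the \<open>N/15\<close> representations win. The constants are
  good enough for all \<open>N \<ge> 136\<close> (\<open>shifted_coeff_nonneg_large\<close>); the remaining \<open>N\<close> are computed.
\<close>

section \<open>Triangular numbers\<close>

definition tri :: "nat \<Rightarrow> nat" where
  "tri s = s * (s + 1) div 2"

lemma tri_double: "tri (2*n) = n * (2*n+1)" "tri (2*n+1) = (n+1) * (2*n+1)"
  by (simp_all add: tri_def algebra_simps)

lemma tri_Suc: "tri (Suc s) = tri s + Suc s"
  by (simp add: tri_def)

lemma tri_ge: "s \<le> tri s"
  by (induction s) (auto simp: tri_Suc tri_def)

lemma strict_mono_tri: "strict_mono tri"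
  by (simp add: strict_mono_Suc_iff tri_Suc)
lemma tri_add: "tri (a + b) = tri a + tri b + a * b"
  by (induction b) (auto simp: tri_Suc tri_def[of 0])

lemma two_tri: "2 * int (tri s) = int s * (int s + 1)"
  by (induction s) (auto simp: tri_Suc tri_def[of 0] algebra_simps)

lemma triangle_number_bounds:
  obtains R where "tri R \<le> N" "N < tri (Suc R)"
proof -
  have "\<exists>k. N < tri k"
    using tri_ge[of "Suc N"] by (intro exI[of _ "Suc N"]) simp
  then have L: "N < tri (LEAST k. N < tri k)" by (rule LeastI_ex)
  then obtain R where R: "(LEAST k. N < tri k) = Suc R"
    by (cases "LEAST k. N < tri k") (auto simp: tri_def)
  moreover have "\<not> N < tri R"
    using R not_less_Least[of R "\<lambda>k. N < tri k"] by simp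
  ultimately show ?thesis using that[of R] L by simp
qed

text \<open>
  The residues modulo 3 decide, through \<open>N - tri a\<close>, which mean value the row \<open>a\<close> has.
\<close>

lemma tri_mod_3: "int (tri (3*j)) mod 3 = 0" "int (tri (3*j+1)) mod 3 = 1" "int (tri (3*j+2)) mod 3 = 0"
proof -
  have "tri (3*j) = 3 * (tri (3*j) div 3) \<and> tri (3*j+1) = 3 * (tri (3*j) div 3 + j) + 1
      \<and> tri (3*j+2) = 3 * (tri (3*j) div 3 + 2*j + 1)"
  proof -
    have "3 dvd tri (3*j)"
    proof (induction j)
      case (Suc j)
      have "3 * Suc j = 3*j + 3" by simp
      then show ?case using Suc by (simp only: tri_add) (simp add: tri_def)
    qed (simp add: tri_def)
    then show ?thesis
      by (simp add: tri_Suc)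
  qed
  then show "int (tri (3*j)) mod 3 = 0" "int (tri (3*j+1)) mod 3 = 1" "int (tri (3*j+2)) mod 3 = 0"
    by presburger+
qed

section \<open>An identity of Gauss, and a closed form of the generating function\<close>

text \<open>
  The quotient \<open>(q\<^sup>2;q\<^sup>2)\<^sub>n / (q;q\<^sup>2)\<^sub>n\<close>, denoted by \<open>P\<^sub>n\<close> in the comments.
\<close>

definition gauss_quot :: "complex \<Rightarrow> nat \<Rightarrow> complex" where
  "gauss_quot q n = (\<Prod>j<n. (1 - q ^ (2*j+2)) / (1 - q ^ (2*j+1)))"

lemma gauss_quot_0 [simp]: "gauss_quot q 0 = 1"
  by (simp add: gauss_quot_def)

context
  fixes q :: complex
  assumes q: "norm q < 1"
begin

lemma one_minus_power_neq_0: "0 < m \<Longrightarrow> 1 - q ^ m \<noteq> 0"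
  using one_minus_power_Suc_nonzero[OF q, of "m - 1"] by simp

lemma gauss_quot_neq_0: "gauss_quot q n \<noteq> 0"
  using one_minus_power_neq_0 by (simp add: gauss_quot_def del: right_minus_eq power_Suc)

lemma gauss_quot_Suc:
  "gauss_quot q (Suc n) * (1 - q ^ (2*n+1)) = gauss_quot q n * (1 - q ^ (2*n+2))"
  using one_minus_power_neq_0[of "2*n+1"] by (simp add: gauss_quot_def field_simps)

text \<open>
  The factor with index \<open>j\<close> differs from 1 by \<open>O(|q|^j)\<close>, and no factor vanishes.
\<close>

lemma gauss_quot_convergent:
  obtains L where "gauss_quot q \<longlonglongrightarrow> L" "L \<noteq> 0"
proof -
  let ?f = "\<lambda>j. (1 - q ^ (2*j+2)) / (1 - q ^ (2*j+1))"
  have nz: "?f j \<noteq> 0" for j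
    using one_minus_power_neq_0[of "2*j+1"] one_minus_power_neq_0[of "2*j+2"] by simp
  have "norm (?f j - 1) \<le> 2 / (1 - norm q) * norm q ^ j" for j
  proof -
    have "?f j - 1 = q ^ (2*j+1) * (1 - q) / (1 - q ^ (2*j+1))"
      using one_minus_power_neq_0[of "2*j+1"] by (simp add: field_simps)
    moreover have "norm (q ^ (2*j+1)) \<le> norm q ^ j"
      unfolding norm_power using q by (intro power_decreasing) auto
    moreover have "norm (1 - q) \<le> 2"
      using norm_triangle_ineq4[of 1 q] q by simp
    moreover have "1 - norm q \<le> norm (1 - q ^ (2*j+1))"
    proof -
      have "norm (q ^ (2*j+1)) \<le> norm q ^ 1"
        unfolding norm_power using q by (intro power_decreasing) auto
      then show ?thesis
        using norm_triangle_ineq2[of 1 "q ^ (2*j+1)"] by simp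
    qed
    ultimately have "norm (?f j - 1) \<le> (norm q ^ j * 2) / (1 - norm q)"
      using q by (simp only: norm_divide norm_mult) (intro frac_le mult_mono; simp)
    then show ?thesis by (simp add: mult_ac)
  qed
  moreover have "summable (\<lambda>j. 2 / (1 - norm q) * norm q ^ j)"
    using q by (intro summable_mult summable_geometric) simp
  ultimately have "summable (\<lambda>j. norm (?f j - 1))"
    by - (rule summable_comparison_test'[where g = "\<lambda>j. 2 / (1 - norm q) * norm q ^ j" and N = 0], simp_all)
  then have conv: "convergent_prod ?f"
    by (intro abs_convergent_prod_imp_convergent_prod summable_imp_abs_convergent_prod)
  from convergent_prod_LIMSEQ[OF this] have "gauss_quot q \<longlonglongrightarrow> prodinf ?f"
    unfolding gauss_quot_def[abs_def] LIMSEQ_lessThan_iff_atMost .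
  moreover have "prodinf ?f \<noteq> 0"
    using prodinf_nonzero[OF conv nz] .
  ultimately show ?thesis
    by (rule that)
qed

lemma gauss_quot_bounded:
  obtains C where "0 < C" "\<And>n. norm (gauss_quot q n) \<le> C" "\<And>n. norm (1 / gauss_quot q n) \<le> C"
proof -
  obtain L where L: "gauss_quot q \<longlonglongrightarrow> L" "L \<noteq> 0"
    by (rule gauss_quot_convergent)
  then have "(\<lambda>n. 1 / gauss_quot q n) \<longlonglongrightarrow> 1 / L"
    by (intro tendsto_intros)
  then have "Bseq (gauss_quot q)" "Bseq (\<lambda>n. 1 / gauss_quot q n)"
    using L convergent_imp_Bseq convergentI by blast+
  then obtain C D where "0 < C" "\<And>n. norm (gauss_quot q n) \<le> C" "\<And>n. norm (1 / gauss_quot q n) \<le> D"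
    unfolding Bseq_def by metis
  then show ?thesis
    by (intro that[of "max C D"]) (auto simp: le_max_iff_disj)
qed

text \<open>
  The induction step of Shanks' identity. With \<open>u = q^(2n+1)\<close>, the summands for \<open>n + 1\<close> and for \<open>n\<close>
  differ by \<open>E\<^sub>s\<^sub>+\<^sub>1 - E\<^sub>s\<close>, where \<open>E\<^sub>s = P\<^sub>n u^s (1 - q^(2s)) / ((1 - u) P\<^sub>s)\<close>; this uses
  \<open>(1 - q^(2s+1)) / P\<^sub>s = (1 - q^(2s+2)) / P\<^sub>s\<^sub>+\<^sub>1\<close>. Hence the sum of the differences collapses to
  \<open>E\<^sub>n\<close>, which combines with the additional summand \<open>s = n\<close>.
\<close>

lemma shanks_step:
  defines "u n \<equiv> q ^ (2*n+1)"
  shows "(\<Sum>s<Suc n. gauss_quot q (Suc n) / gauss_quot q s * u (Suc n) ^ s)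
       = (\<Sum>s<n. gauss_quot q n / gauss_quot q s * u n ^ s) + u n ^ n * (1 + u n)"
proof -
  define P where "P = gauss_quot q"
  define v where "v = u n"
  define E where "E s = P n / (1 - v) * v ^ s * (1 - q ^ (2 * s)) / P s" for s
  have P: "P s \<noteq> 0" for s
    by (simp add: P_def gauss_quot_neq_0)
  have v: "1 - v \<noteq> 0"
    using one_minus_power_neq_0 by (simp add: v_def u_def del: power_Suc)
  have PSuc: "P (Suc n) * (1 - v) = P n * (1 - v * q)"
    using gauss_quot_Suc[of n] by (simp add: P_def v_def u_def mult_ac)
  have tele: "P (Suc n) / P s * u (Suc n) ^ s - P n / P s * v ^ s = E (Suc s) - E s" for s
  proof -
    have 1: "(1 - q ^ (2 * s+2)) / P (Suc s) = (1 - q ^ (2 * s+1)) / P s"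
      using gauss_quot_Suc[of s] P by (simp add: P_def field_simps)
    have 2: "u (Suc n) ^ s = v ^ s * q ^ (2 * s)"
      unfolding v_def u_def power_mult[symmetric] power_add[symmetric]
      by (rule arg_cong[where f = "\<lambda>m. q ^ m"]) (simp add: algebra_simps)
    have 3: "P (Suc n) = P n * (1 - v * q) / (1 - v)"
      using PSuc v by (simp add: field_simps)
    define a b where "a = 1 - q ^ (2 * s)" and "b = 1 - q ^ (2 * s+1)"
    have "E (Suc s) = P n / (1 - v) * v ^ Suc s * ((1 - q ^ (2 * s+2)) / P (Suc s))"
      by (simp add: E_def)
    also have "\<dots> = P n / (1 - v) * v ^ Suc s * (b / P s)"
      by (simp only: 1 b_def)
    finally have "E (Suc s) - E s = P n / (1 - v) * v ^ Suc s * (b / P s) - P n / (1 - v) * v ^ s * a / P s"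
      by (simp only: E_def a_def)
    also have "\<dots> = P n / P s * v ^ s * ((v * b - a) / (1 - v))"
      by (simp add: diff_divide_distrib right_diff_distrib mult_ac)
    also have "v * b - a = (1 - v * q) * q ^ (2 * s) - (1 - v)"
      by (simp add: a_def b_def algebra_simps)
    also have "\<dots> / (1 - v) = (1 - v * q) / (1 - v) * q ^ (2 * s) - 1"
      unfolding diff_divide_distrib[of "(1 - v * q) * q ^ (2 * s)"] using v by simp
    also have "P n / P s * v ^ s * \<dots> = P (Suc n) / P s * u (Suc n) ^ s - P n / P s * v ^ s"
      unfolding 2 3 right_diff_distrib[of "P n / P s * v ^ s"] by (simp add: mult_ac)
    finally show ?thesis ..
  qed
  have "(\<Sum>s<n. P (Suc n) / P s * u (Suc n) ^ s) - (\<Sum>s<n. P n / P s * v ^ s) = E n - E 0"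
    unfolding sum_subtractf[symmetric] tele by (rule sum_lessThan_telescope)
  moreover have "E 0 = 0"
    by (simp add: E_def)
  moreover have "E n + P (Suc n) / P n * u (Suc n) ^ n = v ^ n * (1 + v)"
  proof -
    have 2: "u (Suc n) ^ n = v ^ n * q ^ (2*n)"
      unfolding v_def u_def power_mult[symmetric] power_add[symmetric]
      by (rule arg_cong[where f = "\<lambda>m. q ^ m"]) (simp add: algebra_simps)
    have 3: "P (Suc n) / P n = (1 - v * q) / (1 - v)"
      using PSuc v P[of n] by (simp add: field_simps)
    have 4: "v = q * q ^ (2*n)" by (simp add: v_def u_def)
    have 5: "E n = v ^ n * (1 - q ^ (2*n)) / (1 - v)"
      using P[of n] by (simp add: E_def)
    have "E n + P (Suc n) / P n * u (Suc n) ^ n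
        = v ^ n * ((1 - q ^ (2 * n)) / (1 - v)) + v ^ n * ((1 - v * q) * q ^ (2 * n) / (1 - v))"
      unfolding 2 3 5 by (simp add: mult_ac)
    also have "\<dots> = v ^ n * ((1 - q ^ (2 * n) + (1 - v * q) * q ^ (2 * n)) / (1 - v))"
      by (simp only: distrib_left add_divide_distrib)
    also have "1 - q ^ (2 * n) + (1 - v * q) * q ^ (2 * n) = (1 - v) * (1 + v)"
      using 4 by (simp add: algebra_simps)
    also have "v ^ n * ((1 - v) * (1 + v) / (1 - v)) = v ^ n * (1 + v)"
      using v by simp
    finally show ?thesis .
  qed
  ultimately show ?thesis
    by (simp add: P_def v_def algebra_simps)
qed

text \<open>
  A finite form of Gauss's identity, due to Shanks: its right-hand side is \<open>P\<^sub>n\<close> plus terms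
  that are divisible by \<open>q^(2n+1)\<close>.
\<close>

lemma shanks:
  "(\<Sum>s<2*n. q ^ tri s) = (\<Sum>s<n. gauss_quot q n / gauss_quot q s * (q ^ (2*n+1)) ^ s)"
proof (induction n)
  case (Suc n)
  have "(\<Sum>s<2 * Suc n. q ^ tri s) = (\<Sum>s<2*n. q ^ tri s) + (q ^ tri (2*n) + q ^ tri (2*n+1))"
    by simp
  also have "q ^ tri (2*n) + q ^ tri (2*n+1) = (q ^ (2*n+1)) ^ n * (1 + q ^ (2*n+1))"
  proof -
    have "tri (2*n) = (2*n+1) * n" "tri (2*n+1) = (2*n+1) * n + (2*n+1)"
      unfolding tri_double by (simp_all add: algebra_simps)
    then show ?thesis
      by (simp only: power_mult power_add distrib_left mult_1_right)
  qed
  finally show ?case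
    by (simp only: Suc.IH shanks_step)
qed simp

text \<open>
  Gauss's identity. In Shanks' identity the summand \<open>s = 0\<close> tends to the limit of \<open>P\<^sub>n\<close>, while the
  other summands together are \<open>O(|q|^n)\<close>, because all ratios \<open>P\<^sub>n / P\<^sub>s\<close> are bounded.
\<close>

lemma theta_sums:
  assumes L: "gauss_quot q \<longlonglongrightarrow> L"
  shows "(\<lambda>s. q ^ tri s) sums L"
proof -
  obtain C where C: "0 < C" "\<And>n. norm (gauss_quot q n) \<le> C" "\<And>n. norm (1 / gauss_quot q n) \<le> C"
    using gauss_quot_bounded by blast
  have "summable (\<lambda>s. q ^ tri s)"
  proof (rule summable_comparison_test'[where N = 0])
    show "summable (\<lambda>s. norm q ^ s)"
      using q by (intro summable_geometric) simp
    show "norm (q ^ tri s) \<le> norm q ^ s" for s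
      unfolding norm_power using q tri_ge by (intro power_decreasing) auto
  qed
  then obtain S where S: "(\<lambda>s. q ^ tri s) sums S"
    by blast
  have bound: "norm ((\<Sum>s<2 * Suc n. q ^ tri s) - gauss_quot q (Suc n)) \<le> C * C * norm q ^ n / (1 - norm q)" for n
  proof -
    let ?r = "norm q ^ n"
    have r: "norm q ^ (2 * Suc n + 1) \<le> ?r" "norm q ^ (2 * Suc n + 1) \<le> norm q" "0 \<le> ?r"
      using q power_decreasing[of n "2 * Suc n + 1" "norm q"] power_decreasing[of 1 "2 * Suc n + 1" "norm q"]
      by simp_all
    have summand: "norm (gauss_quot q (Suc n) / gauss_quot q (Suc s) * (q ^ (2 * Suc n + 1)) ^ Suc s)
        \<le> C * C * (?r * norm q ^ s)" for s
    proof -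
      have "norm (q ^ (2 * Suc n + 1)) ^ Suc s \<le> ?r * norm q ^ s"
        unfolding norm_power power_Suc[of _ s] using r by (intro mult_mono power_mono) auto
      moreover have "norm (gauss_quot q (Suc n)) * norm (1 / gauss_quot q (Suc s)) \<le> C * C"
        using C by (intro mult_mono) auto
      ultimately have "norm (gauss_quot q (Suc n)) * norm (1 / gauss_quot q (Suc s)) * norm (q ^ (2 * Suc n + 1)) ^ Suc s
        \<le> C * C * (?r * norm q ^ s)"
        using C by (intro mult_mono) auto
      then show ?thesis
        by (simp add: norm_mult norm_divide norm_power)
    qed
    have "(\<Sum>s<2 * Suc n. q ^ tri s) - gauss_quot q (Suc n)
        = (\<Sum>s<n. gauss_quot q (Suc n) / gauss_quot q (Suc s) * (q ^ (2 * Suc n + 1)) ^ Suc s)"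
      unfolding shanks by (subst sum.lessThan_Suc_shift) simp
    also have "norm \<dots> \<le> (\<Sum>s<n. C * C * (?r * norm q ^ s))"
      by (intro sum_norm_le summand)
    also have "\<dots> = C * C * ?r * (\<Sum>s<n. norm q ^ s)"
      by (simp add: sum_distrib_left mult_ac)
    also have "\<dots> \<le> C * C * ?r * (1 / (1 - norm q))"
    proof (intro mult_left_mono)
      have "(\<Sum>s<n. norm q ^ s) \<le> (\<Sum>s. norm q ^ s)"
        using q by (intro sum_le_suminf summable_geometric) auto
      then show "(\<Sum>s<n. norm q ^ s) \<le> 1 / (1 - norm q)"
        using q by (simp add: suminf_geometric)
    qed (use C in auto)
    finally show ?thesis by simp
  qed
  have "(\<lambda>n. C * C * norm q ^ n / (1 - norm q)) \<longlonglongrightarrow> C * C * 0 / (1 - norm q)"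
    using q by (intro tendsto_intros LIMSEQ_power_zero) auto
  then have "(\<lambda>n. (\<Sum>s<2 * Suc n. q ^ tri s) - gauss_quot q (Suc n)) \<longlonglongrightarrow> 0"
    by (intro Lim_null_comparison[OF always_eventually[OF allI[OF bound]]]) simp
  moreover have "(\<lambda>n. (\<Sum>s<2 * Suc n. q ^ tri s) - gauss_quot q (Suc n)) \<longlonglongrightarrow> S - L"
  proof (intro tendsto_diff)
    show "(\<lambda>n. \<Sum>s<2 * Suc n. q ^ tri s) \<longlonglongrightarrow> S"
      using S unfolding sums_def
      by (rule LIMSEQ_subseq_LIMSEQ[unfolded comp_def]) (simp add: strict_mono_def)
    show "(\<lambda>n. gauss_quot q (Suc n)) \<longlonglongrightarrow> L"
      using L by (rule LIMSEQ_Suc)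
  qed
  ultimately have "S - L = 0"
    using LIMSEQ_unique by blast
  with S show ?thesis by simp
qed

definition recip_series :: "complex \<Rightarrow> complex" where
  "recip_series z = (\<Sum>n. 1 / gauss_quot q n * z ^ n)"

lemma recip_series_summable:
  assumes "norm z < 1"
  shows "summable (\<lambda>n. 1 / gauss_quot q n * z ^ n)"
proof -
  obtain C where C: "0 < C" "\<And>n. norm (1 / gauss_quot q n) \<le> C"
    by (rule gauss_quot_bounded) blast
  show ?thesis
  proof (rule summable_comparison_test'[where N = 0])
    show "summable (\<lambda>n. C * norm z ^ n)"
      using assms by (intro summable_mult summable_geometric) simp
    show "norm (1 / gauss_quot q n * z ^ n) \<le> C * norm z ^ n" for n
      unfolding norm_mult norm_power using C by (intro mult_right_mono) auto
  qed
qed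

text \<open>
  The functional equation of the basic hypergeometric series \<open>\<Sum> (q;q\<^sup>2)\<^sub>n / (q\<^sup>2;q\<^sup>2)\<^sub>n z^n\<close>. It restates
  the recurrence \<open>(1 - q^(2n+2)) / P\<^sub>n\<^sub>+\<^sub>1 = (1 - q^(2n+1)) / P\<^sub>n\<close> of its coefficients.
\<close>

lemma recip_series_eq:
  assumes z: "norm z < 1"
  shows "(1 - z) * recip_series z = (1 - q * z) * recip_series (q\<^sup>2 * z)"
proof -
  let ?c = "\<lambda>n. 1 / gauss_quot q n"
  have "norm (q\<^sup>2) * norm z \<le> 1 * norm z"
    using q by (intro mult_right_mono) (auto simp: norm_power abs_square_le_1)
  then have z2: "norm (q\<^sup>2 * z) < 1"
    using z by (simp add: norm_mult)
  have 1: "(\<lambda>n. ?c n * z ^ n) sums recip_series z"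
    using recip_series_summable[OF z] by (simp add: recip_series_def summable_sums)
  have 2: "(\<lambda>n. ?c n * (q\<^sup>2 * z) ^ n) sums recip_series (q\<^sup>2 * z)"
    using recip_series_summable[OF z2] by (simp add: recip_series_def summable_sums)
  have A: "(\<lambda>n. ?c n * z ^ n - ?c n * (q\<^sup>2 * z) ^ n) sums (recip_series z - recip_series (q\<^sup>2 * z))"
    using 1 2 by (rule sums_diff)
  have "(\<lambda>n. z * (?c n * z ^ n) - z * q * (?c n * (q\<^sup>2 * z) ^ n)) sums (z * recip_series z - z * q * recip_series (q\<^sup>2 * z))"
    using 1 2 by (intro sums_diff sums_mult)
  moreover have "?c (Suc n) * z ^ Suc n - ?c (Suc n) * (q\<^sup>2 * z) ^ Suc n
      = z * (?c n * z ^ n) - z * q * (?c n * (q\<^sup>2 * z) ^ n)" for n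
  proof -
    have "?c (Suc n) * (1 - q ^ (2*n+2)) = ?c n * (1 - q ^ (2*n+1))"
      using gauss_quot_Suc[of n] gauss_quot_neq_0 by (simp add: field_simps)
    moreover have "?c (Suc n) * z ^ Suc n - ?c (Suc n) * (q\<^sup>2 * z) ^ Suc n
        = ?c (Suc n) * (1 - q ^ (2*n+2)) * z ^ Suc n"
      by (simp add: power_mult_distrib right_diff_distrib left_diff_distrib mult_ac flip: power_mult power_add)
    moreover have "z * (?c n * z ^ n) - z * q * (?c n * (q\<^sup>2 * z) ^ n) = ?c n * (1 - q ^ (2*n+1)) * z ^ Suc n"
      by (simp add: power_mult_distrib algebra_simps flip: power_mult)
    ultimately show ?thesis by metis
  qed
  ultimately have "(\<lambda>n. ?c (Suc n) * z ^ Suc n - ?c (Suc n) * (q\<^sup>2 * z) ^ Suc n) sums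
      (z * recip_series z - z * q * recip_series (q\<^sup>2 * z))"
    by simp
  from sums_Suc[OF this] have "(\<lambda>n. ?c n * z ^ n - ?c n * (q\<^sup>2 * z) ^ n) sums
      (z * recip_series z - z * q * recip_series (q\<^sup>2 * z))"
    by simp
  with A have "recip_series z - recip_series (q\<^sup>2 * z) = z * recip_series z - z * q * recip_series (q\<^sup>2 * z)"
    by (rule sums_unique2)
  then show ?thesis by (simp add: algebra_simps)
qed

text \<open>
  Let \<open>F\<close> denote \<open>recip_series\<close>. At \<open>z = q^(2j+1)\<close> the factors in the functional equation are those of \<open>P\<^sub>j\<^sub>+\<^sub>1 / P\<^sub>j\<close>, so
  \<open>P\<^sub>j F(q^(2j+1))\<close> does not depend on \<open>j\<close>. Its limit is \<open>L \<cdot> F(0) = L\<close>, and \<open>P\<^sub>1 = 1 + q\<close>.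
\<close>

lemma recip_series_cube:
  assumes L: "gauss_quot q \<longlonglongrightarrow> L"
  shows "(1 + q) * recip_series (q ^ 3) = L"
proof -
  let ?F = "\<lambda>j. gauss_quot q j * recip_series (q ^ (2*j+1))"
  have step: "?F (Suc j) = ?F j" for j
  proof -
    have "norm (q ^ (2*j+1)) < 1"
      unfolding norm_power using q by (subst power_less_one_iff) auto
    from recip_series_eq[OF this]
    have "(1 - q ^ (2*j+1)) * recip_series (q ^ (2*j+1)) = (1 - q ^ (2*j+2)) * recip_series (q ^ (2 * Suc j + 1))"
      by (simp add: power2_eq_square mult_ac)
    then have "(1 - q ^ (2*j+1)) * ?F j = (1 - q ^ (2*j+1)) * ?F (Suc j)"
      using gauss_quot_Suc[of j] by (simp add: mult_ac)
    then show ?thesis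
      using one_minus_power_neq_0[of "2*j+1"] by simp
  qed
  have const: "?F j = ?F 1" for j
  proof (induction j)
    case 0 then show ?case using step[of 0] by simp
  next
    case (Suc j) then show ?case using step[of j] by simp
  qed
  have "recip_series 0 = 1"
    unfolding recip_series_def by (subst powser_zero) simp
  moreover have "isCont recip_series 0"
    unfolding recip_series_def[abs_def]
    by (rule isCont_powser[where K = "1/2"]) (use recip_series_summable[of "1/2"] in auto)
  moreover have "(\<lambda>j. q ^ (2*j+1)) \<longlonglongrightarrow> 0"
    using LIMSEQ_subseq_LIMSEQ[OF LIMSEQ_power_zero[OF q], of "\<lambda>j. 2*j+1"]
    by (simp add: strict_mono_def comp_def)
  ultimately have "(\<lambda>j. recip_series (q ^ (2*j+1))) \<longlonglongrightarrow> 1"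
    using isCont_tendsto_compose by fastforce
  with L have "?F \<longlonglongrightarrow> L * 1"
    by (intro tendsto_intros)
  moreover have "?F \<longlonglongrightarrow> ?F 1"
    by (intro tendsto_eventually always_eventually allI const)
  ultimately have "?F 1 = L"
    using LIMSEQ_unique by force
  moreover have "gauss_quot q 1 = 1 + q"
    using one_minus_power_neq_0[of 1] by (simp add: gauss_quot_def divide_simps power2_eq_square algebra_simps)
  ultimately show ?thesis by (simp add: numeral_3_eq_3)
qed

lemma G_term_gauss_quot:
  "G_term q k n = gauss_quot q (n + k) / gauss_quot q n * q ^ (2*k+5*n+2)"
proof -
  have "gauss_quot q (n + k) = gauss_quot q n * (\<Prod>j<k. (1 - q ^ (2*(n+j)+2)) / (1 - q ^ (2*(n+j)+1)))"
    unfolding gauss_quot_def by (induction k) simp_all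
  then show ?thesis
    using gauss_quot_neq_0[of n] by (simp add: G_term_eq)
qed

text \<open>
  Multiplied by \<open>1 - q\<^sup>3\<close>, the summand is the difference of \<open>P\<^sub>n\<^sub>+\<^sub>k (q^(3n+3) - q^(5n+2k+2)) / P\<^sub>n\<close> at
  \<open>k + 1\<close> and at \<open>k\<close>. Indeed the quantity \<open>D\<^sub>k = A\<^sub>k (1 - q^(2n+2k-1))\<close> with \<open>A\<^sub>k = P\<^sub>n\<^sub>+\<^sub>k / P\<^sub>n\<close> satisfies
  \<open>D\<^sub>k\<^sub>+\<^sub>1 - D\<^sub>k = A\<^sub>k q^(2n+2k-1) (1 - q\<^sup>3)\<close>, and multiplication by \<open>q^(3n+3)\<close> clears the negative power
  and supplies the weight of row \<open>n\<close>.
\<close>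

lemma G_term_row_sums:
  assumes L: "gauss_quot q \<longlonglongrightarrow> L"
  shows "(\<lambda>k. (1 - q ^ 3) * G_term q k n) sums
           (q ^ 3 * L * (1 / gauss_quot q n * (q ^ 3) ^ n) - q ^ 3 * (q ^ 3) ^ n + q\<^sup>2 * (q ^ 5) ^ n)"
proof -
  let ?D = "\<lambda>k. gauss_quot q (n + k) / gauss_quot q n * (q ^ (3*n+3) - q ^ (5*n+2*k+2))"
  have "?D (Suc k) - ?D k = (1 - q ^ 3) * G_term q k n" for k
  proof -
    have "?D (Suc k) = gauss_quot q (Suc (n + k)) * (1 - q ^ (2*(n+k)+1)) / gauss_quot q n * q ^ (3*n+3)"
    proof -
      have "q ^ (3*n+3) - q ^ (5*n+2*Suc k+2) = (1 - q ^ (2*(n+k)+1)) * q ^ (3*n+3)"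
      proof -
        have "5*n+2*Suc k+2 = 2*(n+k)+1 + (3*n+3)" by simp
        then have "q ^ (5*n+2*Suc k+2) = q ^ (2*(n+k)+1) * q ^ (3*n+3)"
          by (simp only: power_add)
        then show ?thesis
          by (simp only: left_diff_distrib mult_1_left)
      qed
      then show ?thesis by simp
    qed
    also have "\<dots> = gauss_quot q (n + k) * (1 - q ^ (2*(n+k)+2)) / gauss_quot q n * q ^ (3*n+3)"
      by (simp only: gauss_quot_Suc)
    finally have "?D (Suc k) - ?D k = gauss_quot q (n + k) / gauss_quot q n *
        ((1 - q ^ (2*(n+k)+2)) * q ^ (3*n+3) - (q ^ (3*n+3) - q ^ (5*n+2*k+2)))"
      by (simp add: right_diff_distrib)
    also have "(1 - q ^ (2*(n+k)+2)) * q ^ (3*n+3) - (q ^ (3*n+3) - q ^ (5*n+2*k+2))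
        = (1 - q ^ 3) * q ^ (2*k+5*n+2)"
    proof -
      have "2*(n+k)+2 + (3*n+3) = 3 + (2*k+5*n+2)" "5*n+2*k+2 = 2*k+5*n+2" by simp_all
      then have "q ^ (2*(n+k)+2) * q ^ (3*n+3) = q ^ 3 * q ^ (2*k+5*n+2)" "q ^ (5*n+2*k+2) = q ^ (2*k+5*n+2)"
        by (simp_all only: power_add[symmetric])
      then show ?thesis
        by (simp only: left_diff_distrib mult_1_left) simp
    qed
    finally show ?thesis
      by (simp only: G_term_gauss_quot mult_ac)
  qed
  moreover have "?D \<longlonglongrightarrow> L / gauss_quot q n * (q ^ (3*n+3) - 0)"
  proof (intro tendsto_mult tendsto_diff tendsto_divide tendsto_const)
    show "(\<lambda>k. gauss_quot q (n + k)) \<longlonglongrightarrow> L"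
      using LIMSEQ_ignore_initial_segment[OF L, of n] by (simp add: add.commute)
    show "(\<lambda>k. q ^ (5*n+2*k+2)) \<longlonglongrightarrow> 0"
      using LIMSEQ_subseq_LIMSEQ[OF LIMSEQ_power_zero[OF q], of "\<lambda>k. 5*n+2*k+2"]
      by (simp add: strict_mono_def comp_def)
  qed (rule gauss_quot_neq_0)
  ultimately have "(\<lambda>k. (1 - q ^ 3) * G_term q k n) sums (L / gauss_quot q n * q ^ (3*n+3) - ?D 0)"
    using telescope_sums[of ?D] by simp
  then show ?thesis
    using gauss_quot_neq_0[of n] by (simp add: field_simps flip: power_add power_mult)
qed

lemma G_fun_closed_form:
  assumes L: "gauss_quot q \<longlonglongrightarrow> L"
  shows "(1 - q ^ 3) * G_fun q = q ^ 3 * L\<^sup>2 / (1 + q) - q ^ 3 / (1 - q ^ 3) + q\<^sup>2 / (1 - q ^ 5)"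
proof -
  have "(\<lambda>(k, n). G_term q k n) summable_on UNIV"
    by (rule abs_summable_summable) (use G_term_summable[OF q] in \<open>simp add: case_prod_unfold\<close>)
  then have "((\<lambda>(k, n). G_term q k n) has_sum G_fun q) (UNIV \<times> UNIV)"
    by (simp add: G_fun_def)
  then have "((\<lambda>x. (1 - q ^ 3) * (case x of (k, n) \<Rightarrow> G_term q k n)) has_sum ((1 - q ^ 3) * G_fun q)) (UNIV \<times> UNIV)"
    by (rule has_sum_cmult_right)
  then have hs: "((\<lambda>(n, k). (1 - q ^ 3) * G_term q k n) has_sum ((1 - q ^ 3) * G_fun q)) (UNIV \<times> UNIV)"
    by (subst (asm) has_sum_swap) (simp add: case_prod_unfold)
  have row: "((\<lambda>k. (1 - q ^ 3) * G_term q k n) has_sum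
      (q ^ 3 * L * (1 / gauss_quot q n * (q ^ 3) ^ n) - q ^ 3 * (q ^ 3) ^ n + q\<^sup>2 * (q ^ 5) ^ n)) UNIV" for n
  proof -
    have "(\<lambda>(n, k). (1 - q ^ 3) * G_term q k n) summable_on Sigma UNIV (\<lambda>_. UNIV)"
      using hs by (auto simp: summable_on_def)
    from summable_on_SigmaD1[OF this, of n]
    obtain S where S: "((\<lambda>k. (1 - q ^ 3) * G_term q k n) has_sum S) UNIV"
      by (auto simp: summable_on_def)
    with G_term_row_sums[OF L, of n] show ?thesis
      using has_sum_imp_sums sums_unique2 by blast
  qed
  have "((\<lambda>n. q ^ 3 * L * (1 / gauss_quot q n * (q ^ 3) ^ n) - q ^ 3 * (q ^ 3) ^ n + q\<^sup>2 * (q ^ 5) ^ n)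
      has_sum ((1 - q ^ 3) * G_fun q)) UNIV"
    by (rule has_sum_SigmaD[OF hs]) (use row in simp)
  then have "(\<lambda>n. q ^ 3 * L * (1 / gauss_quot q n * (q ^ 3) ^ n) - q ^ 3 * (q ^ 3) ^ n + q\<^sup>2 * (q ^ 5) ^ n)
      sums ((1 - q ^ 3) * G_fun q)"
    by (rule has_sum_imp_sums)
  moreover have "(\<lambda>n. q ^ 3 * L * (1 / gauss_quot q n * (q ^ 3) ^ n) - q ^ 3 * (q ^ 3) ^ n + q\<^sup>2 * (q ^ 5) ^ n)
      sums (q ^ 3 * L * recip_series (q ^ 3) - q ^ 3 * (1 / (1 - q ^ 3)) + q\<^sup>2 * (1 / (1 - q ^ 5)))"
  proof (intro sums_add sums_diff sums_mult geometric_sums)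
    have pow: "norm (q ^ m) < 1" if "0 < m" for m
      unfolding norm_power using q that by (subst power_less_one_iff) auto
    show "norm (q ^ 3) < 1" "norm (q ^ 5) < 1"
      by (rule pow, simp)+
    show "(\<lambda>n. 1 / gauss_quot q n * (q ^ 3) ^ n) sums recip_series (q ^ 3)"
      unfolding recip_series_def by (intro summable_sums recip_series_summable pow) simp
  qed
  ultimately have "(1 - q ^ 3) * G_fun q
      = q ^ 3 * L * recip_series (q ^ 3) - q ^ 3 * (1 / (1 - q ^ 3)) + q\<^sup>2 * (1 / (1 - q ^ 5))"
    by (rule sums_unique2)
  moreover have "recip_series (q ^ 3) = L / (1 + q)"
  proof -
    have "1 + q \<noteq> 0"
      using q by (metis add_eq_0_iff norm_minus_cancel norm_one order_less_irrefl)
    then show ?thesis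
      using recip_series_cube[OF L] by (simp add: field_simps)
  qed
  ultimately show ?thesis
    by (simp add: power2_eq_square)
qed

end

section \<open>Passage to formal power series\<close>

text \<open>
  The coefficients \<open>1, -1, 1, 0, 0, 0, \<dots>\<close> of \<open>1 / ((1 + X)(1 - X\<^sup>3)) = (1 - X + X\<^sup>2) / (1 - X\<^sup>6)\<close>, extended
  periodically to all integers so that differences need no side conditions.
\<close>

definition hexa :: "int \<Rightarrow> int" where
  "hexa k = (let r = k mod 6 in if r = 0 \<or> r = 2 then 1 else if r = 1 then -1 else 0)"
lemma hexa_mod: "hexa k = hexa (k mod 6)"
  by (simp add: hexa_def)

lemma hexa_add: "hexa (k + l) = hexa (k mod 6 + l)"
  by (simp add: hexa_def mod_add_left_eq)

definition theta_fps :: "complex fps" where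
  "theta_fps = Abs_fps (\<lambda>n. of_bool (n \<in> range tri))"

text \<open>
  The series \<open>1 / (1 - X^k)\<close>.
\<close>

definition geo :: "nat \<Rightarrow> complex fps" where
  "geo k = Abs_fps (\<lambda>n. of_bool (k dvd n))"

lemma theta_fps_mult_nth: "fps_nth (theta_fps * F) n = (\<Sum>s | tri s \<le> n. fps_nth F (n - tri s))"
proof -
  have inj: "inj_on tri A" for A
    using strict_mono_tri by (meson inj_on_subset strict_mono_imp_inj_on top_greatest)
  have "fps_nth (theta_fps * F) n = (\<Sum>i\<in>tri ` {s. tri s \<le> n}. fps_nth F (n - i))"
    unfolding fps_mult_nth theta_fps_def by (intro sum.mono_neutral_cong_right) auto
  also have "\<dots> = (\<Sum>s | tri s \<le> n. fps_nth F (n - tri s))"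
    by (simp add: sum.reindex[OF inj])
  finally show ?thesis .
qed

lemma geo_mult: "0 < k \<Longrightarrow> (1 - fps_X ^ k) * geo k = 1"
  by (rule fps_ext) (auto simp: geo_def left_diff_distrib fps_X_power_mult_nth dvd_diff_nat dvd_imp_le
      dest: dvd_minus_self[THEN iffD1])

lemma geo_cancel:
  assumes "0 < k"
  shows "geo k * ((1 - fps_X ^ k) * F) = F"
proof -
  have "geo k * ((1 - fps_X ^ k) * F) = (1 - fps_X ^ k) * geo k * F"
    by (simp only: mult_ac)
  then show ?thesis
    by (simp only: geo_mult[OF assms] mult_1_left)
qed

lemma geo_mult_self:
  assumes "0 < k"
  shows "geo k * geo k = Abs_fps (\<lambda>n. of_bool (k dvd n) * (of_nat (n div k) + 1))"
proof -
  have "(1 - fps_X ^ k) * Abs_fps (\<lambda>n. of_bool (k dvd n) * (of_nat (n div k) + 1)) = geo k"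
  proof (rule fps_ext)
    fix n
    show "fps_nth ((1 - fps_X ^ k) * Abs_fps (\<lambda>n. of_bool (k dvd n) * (of_nat (n div k) + 1))) n = fps_nth (geo k) n"
    proof (cases "n < k")
      case False
      then have "k dvd n - k \<longleftrightarrow> k dvd n" "n div k = Suc ((n - k) div k)"
        using assms by (auto simp: dvd_minus_self le_div_geq)
      with False show ?thesis
        by (simp add: geo_def left_diff_distrib fps_X_power_mult_nth)
    qed (simp add: geo_def left_diff_distrib fps_X_power_mult_nth)
  qed
  then show ?thesis
    using geo_cancel[OF assms] by metis
qed

lemma geo_mult_geo_nth:
  "fps_nth (geo a * geo b) n = of_nat (card {i. i \<le> n \<and> a dvd i \<and> b dvd n - i})"
proof -
  have "fps_nth (geo a * geo b) n = (\<Sum>i\<in>{0..n}. of_bool (a dvd i \<and> b dvd n - i))"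
    unfolding fps_mult_nth geo_def by (intro sum.cong) auto
  also have "\<dots> = of_nat (card ({0..n} \<inter> {i. a dvd i \<and> b dvd n - i}))"
    by (subst sum_of_bool_eq) auto
  also have "{0..n} \<inter> {i. a dvd i \<and> b dvd n - i} = {i. i \<le> n \<and> a dvd i \<and> b dvd n - i}"
    by auto
  finally show ?thesis .
qed

lemma hexa_fps:
  "(1 + fps_X) * ((1 - fps_X ^ 3) * Abs_fps (\<lambda>n. of_int (hexa (int n)))) = (1 :: complex fps)"
proof (rule fps_ext)
  fix n :: nat
  have *: "(1 + fps_X) * ((1 - fps_X ^ 3) * Abs_fps (\<lambda>n. of_int (hexa (int n))))
     = (1 + fps_X ^ 1 - fps_X ^ 3 - fps_X ^ 4) * (Abs_fps (\<lambda>n. of_int (hexa (int n))) :: complex fps)"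
    by (simp add: algebra_simps flip: power_Suc)
  consider "n = 0" | "n = 1" | "n = 2" | "n = 3" | m where "n = m + 4"
  proof -
    have "n = 0 \<or> n = 1 \<or> n = 2 \<or> n = 3 \<or> n = (n - 4) + 4"
      by presburger
    then show thesis using that by blast
  qed
  then show "fps_nth ((1 + fps_X) * ((1 - fps_X ^ 3) * Abs_fps (\<lambda>n. of_int (hexa (int n))))) n = fps_nth (1 :: complex fps) n"
  proof cases
    case 5
    have "hexa (int m + 4) + hexa (int m + 3) - hexa (int m + 1) - hexa (int m) = 0"
    proof -
      have "int m mod 6 \<in> {0, 1, 2, 3, 4, 5}" by auto
      then show ?thesis
        unfolding hexa_add[of "int m"] hexa_mod[of "int m"] by (elim insertE) (simp_all add: hexa_def)
    qed
    then have "of_int (hexa (int m + 4) + hexa (int m + 3) - hexa (int m + 1) - hexa (int m)) = (0 :: complex)"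
      by simp
    with 5 show ?thesis
      unfolding * by (simp add: distrib_right left_diff_distrib fps_X_power_mult_nth del: power_one_right)
        (simp add: add_ac)
  qed (unfold *, simp_all add: distrib_right left_diff_distrib fps_X_power_mult_nth hexa_def del: power_one_right)
qed

lemma theta_has_fps_expansion:
  assumes "\<And>q. norm q < 1 \<Longrightarrow> (\<lambda>s. q ^ tri s) sums f q"
  shows "f has_fps_expansion theta_fps"
proof (rule has_fps_expansionI)
  have "(\<lambda>n. fps_nth theta_fps n * q ^ n) sums f q" if q: "norm q < 1" for q
  proof -
    have "(\<lambda>s. fps_nth theta_fps (tri s) * q ^ tri s) sums f q"
      using assms[OF q] by (simp add: theta_fps_def)
    moreover have "fps_nth theta_fps n * q ^ n = 0" if "n \<notin> range tri" for n
      using that by (simp add: theta_fps_def)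
    ultimately show ?thesis
      by (subst sums_mono_reindex[OF strict_mono_tri, symmetric]) auto
  qed
  moreover have "\<forall>\<^sub>F q :: complex in nhds 0. norm q < 1"
    using eventually_nhds_in_open[of "ball 0 1" "0::complex"] by simp
  ultimately show "\<forall>\<^sub>F q in nhds 0. (\<lambda>n. fps_nth theta_fps n * q ^ n) sums f q"
    by (auto elim: eventually_mono)
qed

text \<open>
  Both sides of the closed form are expanded at 0 and compared; division by \<open>1 - X\<^sup>3\<close> is
  multiplication by its inverse \<open>geo 3\<close>.
\<close>

lemma power_series_fps_identity:
  fixes G :: "nat \<Rightarrow> complex" and f g :: "complex \<Rightarrow> complex"
  assumes g: "\<And>q. norm q < 1 \<Longrightarrow> (\<lambda>n. G n * q ^ n) sums g q"
    and f: "f has_fps_expansion theta_fps"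
    and eq: "\<And>q. norm q < 1 \<Longrightarrow>
      (1 - q ^ 3) * g q = q ^ 3 * (f q)\<^sup>2 / (1 + q) - q ^ 3 / (1 - q ^ 3) + q\<^sup>2 / (1 - q ^ 5)"
  shows "Abs_fps G = fps_X ^ 3 * (theta_fps * (theta_fps * Abs_fps (\<lambda>n. of_int (hexa (int n)))))
      - fps_X ^ 3 * (geo 3 * geo 3) + fps_X\<^sup>2 * (geo 3 * geo 5)"
proof -
  define C :: "complex fps" where "C = Abs_fps (\<lambda>n. of_int (hexa (int n)))"
  have near: "\<forall>\<^sub>F q :: complex in nhds 0. norm q < 1"
    using eventually_nhds_in_open[of "ball 0 1" "0::complex"] by simp
  have geo_inv: "geo k = inverse (1 - fps_X ^ k)" if "0 < k" for k
    by (rule fps_inverse_unique[symmetric, OF geo_mult[OF that]])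
  have C_inv: "(1 - fps_X ^ 3) * C = inverse (1 + fps_X)"
    by (rule fps_inverse_unique[symmetric]) (simp only: hexa_fps C_def)
  have "g has_fps_expansion Abs_fps G"
    by (rule has_fps_expansionI) (use near g in \<open>auto elim: eventually_mono\<close>)
  then have "(\<lambda>q. (1 - q ^ 3) * g q) has_fps_expansion (1 - fps_X ^ 3) * Abs_fps G"
    by (intro fps_expansion_intros)
  moreover have "(\<lambda>q. (1 - q ^ 3) * g q) has_fps_expansion
      fps_X ^ 3 * (theta_fps * theta_fps) * inverse (1 + fps_X) - fps_X ^ 3 * inverse (1 - fps_X ^ 3)
      + fps_X\<^sup>2 * inverse (1 - fps_X ^ 5)" (is "_ has_fps_expansion ?R")
  proof -
    have "(\<lambda>q. q ^ 3 * (f q * f q) * inverse (1 + q) - q ^ 3 * inverse (1 - q ^ 3)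
        + q\<^sup>2 * inverse (1 - q ^ 5)) has_fps_expansion ?R"
      by (intro fps_expansion_intros f) simp_all
    moreover have "\<forall>\<^sub>F q in nhds 0. q ^ 3 * (f q * f q) * inverse (1 + q) - q ^ 3 * inverse (1 - q ^ 3)
        + q\<^sup>2 * inverse (1 - q ^ 5) = (1 - q ^ 3) * g q"
      using near by eventually_elim (simp add: eq power2_eq_square divide_inverse)
    ultimately show ?thesis
      by (subst (asm) has_fps_expansion_cong[OF _ refl]) auto
  qed
  ultimately have "(1 - fps_X ^ 3) * Abs_fps G = ?R"
    by (rule fps_expansion_unique_complex)
  then have "geo 3 * ((1 - fps_X ^ 3) * Abs_fps G) =
      geo 3 * (fps_X ^ 3 * (theta_fps * theta_fps) * ((1 - fps_X ^ 3) * C) - fps_X ^ 3 * geo 3 + fps_X\<^sup>2 * geo 5)"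
    by (simp add: C_inv geo_inv)
  moreover have "geo 3 * (A * ((1 - fps_X ^ 3) * C) - B * geo 3 + D * geo 5)
      = A * C - B * (geo 3 * geo 3) + D * (geo 3 * geo 5)" for A B D
  proof -
    have "geo 3 * (A * ((1 - fps_X ^ 3) * C)) = A * C"
      using geo_cancel[of 3 "A * C"] by (simp only: mult.left_commute)
    then show ?thesis
      by (simp add: distrib_left right_diff_distrib mult_ac)
  qed
  ultimately have "Abs_fps G = fps_X ^ 3 * (theta_fps * theta_fps) * C
      - fps_X ^ 3 * (geo 3 * geo 3) + fps_X\<^sup>2 * (geo 3 * geo 5)"
    by (simp only: geo_cancel zero_less_numeral)
  then show ?thesis
    by (simp only: C_def mult.assoc)
qed

section \<open>Row sums of the periodic weight\<close>

text \<open>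
  The sum over the first \<open>B\<close> points of a row of the lattice region, where \<open>r\<close> stands for \<open>N - tri a\<close>.
\<close>

definition row_sum :: "int \<Rightarrow> nat \<Rightarrow> int" where
  "row_sum r B = (\<Sum>b<B. hexa (r - int (tri b)))"

lemma row_sum_Suc: "row_sum r (Suc B) = row_sum r B + hexa (r - int (tri B))"
  by (simp add: row_sum_def)

lemma row_sum_mod: "row_sum r B = row_sum (r mod 6) B"
  unfolding row_sum_def diff_conv_add_uminus by (subst hexa_add) (rule refl)

text \<open>
  Triangular numbers have period 12 modulo 6.
\<close>

lemma hexa_diff_tri_periodic: "hexa (r - int (tri (12 + b))) = hexa (r - int (tri b))"
proof -
  have "tri (12 + b) = tri b + 6 * (13 + 2 * b)"
    unfolding tri_add by (simp add: tri_def)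
  then have "r - int (tri (12 + b)) = (r - int (tri b)) + 6 * (- (13 + 2 * int b))"
    by simp
  then show ?thesis
    by (simp only: hexa_def mod_mult_self2)
qed

lemma row_sum_add_12: "row_sum r (12 + B) = row_sum r 12 + row_sum r B"
proof (induction B)
  case (Suc B)
  then show ?case
    using hexa_diff_tri_periodic[of r B] by (simp only: row_sum_Suc add_Suc_right)
qed (simp add: row_sum_def)

text \<open>
  Over a full period of 12 points the weights add up to 6, -2 or 2. The bounds compare a row with
  its mean \<open>B/2\<close>, \<open>-B/6\<close> or \<open>B/6\<close>; the constants are the worst deviations of the partial
  sums within one period.
\<close>

definition row_bound :: "int \<Rightarrow> nat \<Rightarrow> bool" where
  "row_bound r B \<longleftrightarrow>
    (r mod 3 = 0 \<longrightarrow> 2 * row_sum r B \<ge> int B - 1) \<and>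
    (r mod 3 = 1 \<longrightarrow> 6 * row_sum r B \<ge> - int B - 5) \<and>
    (r mod 3 = 2 \<longrightarrow> row_sum r B \<ge> 0 \<and> 6 * row_sum r B \<ge> int B - 5)"

lemma row_bound_base: "list_all (\<lambda>r. list_all (row_bound r) [0..<12]) [0,1,2,3,4,5]"
  by (simp add: row_bound_def row_sum_def hexa_def tri_def upt_rec lessThan_nat_numeral lessThan_Suc)

lemma row_sum_12:
  assumes "r \<in> {0, 1, 2, 3, 4, 5}"
  shows "row_sum r 12 = (if r mod 3 = 0 then 6 else if r mod 3 = 1 then -2 else 2)"
  using assms by (auto simp: row_sum_def hexa_def tri_def lessThan_nat_numeral lessThan_Suc)

text \<open>
  The bounds are additive over periods, so the first period decides.
\<close>

lemma row_bound: "row_bound r B"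
proof -
  have "row_bound r B" if r: "r \<in> {0, 1, 2, 3, 4, 5}" for r
  proof (induction B rule: less_induct)
    case (less B)
    show ?case
    proof (cases "B < 12")
      case True
      then show ?thesis using row_bound_base r by (auto simp: list_all_iff)
    next
      case False
      then obtain B' where B': "B = 12 + B'" by (metis le_Suc_ex not_less)
      then have "row_bound r B'" using less by simp
      then show ?thesis
        unfolding B' row_bound_def row_sum_add_12 row_sum_12[OF r] by auto
    qed
  qed
  moreover have "r mod 6 \<in> {0, 1, 2, 3, 4, 5}"
    by auto
  ultimately have "row_bound (r mod 6) B" .
  then show ?thesis
    unfolding row_bound_def row_sum_mod[of r] by (simp add: mod_mod_cancel)
qed

definition row_len :: "nat \<Rightarrow> nat \<Rightarrow> nat" where
  "row_len N a = card {b. tri a + tri b \<le> N}"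

lemma lessThan_row_len: "{b. tri a + tri b \<le> N} = {..<row_len N a}"
proof -
  define k where "k = (LEAST b. \<not> tri a + tri b \<le> N)"
  have ex: "\<not> tri a + tri (Suc N) \<le> N"
    using tri_ge[of "Suc N"] by simp
  have "\<not> tri a + tri k \<le> N"
    unfolding k_def using ex by (rule LeastI)
  then have "b < k" if "tri a + tri b \<le> N" for b
    using that strict_mono_less_eq[OF strict_mono_tri, of k b] by (meson add_le_cancel_left not_le order_trans)
  moreover have "tri a + tri b \<le> N" if "b < k" for b
    using that not_less_Least unfolding k_def by blast
  ultimately have "{b. tri a + tri b \<le> N} = {..<k}"
    by auto
  then show ?thesis
    by (simp add: row_len_def)
qed

lemma row_len_antimono:
  assumes "a \<le> a'"
  shows "row_len N a' \<le> row_len N a"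
proof -
  have "tri a \<le> tri a'"
    using assms by (rule strict_mono_leD[OF strict_mono_tri])
  then have "{..<row_len N a'} \<subseteq> {..<row_len N a}"
    unfolding lessThan_row_len[symmetric] by auto
  then show ?thesis by simp
qed

text \<open>
  The triangle \<open>a + b \<le> R\<close> lies in the region, since \<open>tri a + tri b \<le> tri (a + b)\<close>.
\<close>

lemma row_len_ge:
  assumes "tri R \<le> N"
  shows "int R + 1 - int a \<le> int (row_len N a)"
proof (cases "a \<le> R")
  case True
  then have "tri a + tri (R - a) \<le> tri R"
    using tri_add[of a "R - a"] by simp
  with assms have "R - a \<in> {..<row_len N a}"
    unfolding lessThan_row_len[symmetric] by simp
  with True show ?thesis by auto
qed simp

lemma row_len_0:
  assumes "N < tri (Suc R)"
  shows "row_len N 0 \<le> Suc R"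
proof -
  have "Suc R \<notin> {..<row_len N 0}"
    unfolding lessThan_row_len[symmetric] using assms by simp
  then show ?thesis by simp
qed

lemma row_len_eq_0:
  assumes "N < tri a"
  shows "row_len N a = 0"
  using assms by (simp add: row_len_def)

definition tri_row :: "nat \<Rightarrow> nat \<Rightarrow> int" where
  "tri_row N a = row_sum (int N - int (tri a)) (row_len N a)"

lemma tri_row_eq_0: "N < tri a \<Longrightarrow> tri_row N a = 0"
  by (simp add: tri_row_def row_len_eq_0 row_sum_def)

lemma tri_row_altdef:
  assumes "tri a \<le> N"
  shows "tri_row N a = (\<Sum>b | tri b \<le> N - tri a. hexa (int (N - tri a - tri b)))"
proof -
  have "{b. tri b \<le> N - tri a} = {..<row_len N a}"
    using assms unfolding lessThan_row_len[symmetric] by auto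
  moreover have "int (N - tri a - tri b) = int N - int (tri a) - int (tri b)" if "b \<in> {..<row_len N a}" for b
    using that assms unfolding lessThan_row_len[symmetric] by auto
  ultimately show ?thesis
    by (simp add: tri_row_def row_sum_def)
qed

definition tri_sum :: "nat \<Rightarrow> int" where
  "tri_sum N = (\<Sum>a | tri a \<le> N. tri_row N a)"

text \<open>
  Blocks of three rows are natural because \<open>tri a\<close> has period 3 modulo 3. Rows beyond the boundary of
  the region are empty, which allows any sufficiently large number of complete blocks.
\<close>

lemma tri_sum_blocks:
  assumes "N < tri (3 * J)"
  shows "tri_sum N = (\<Sum>j<J. tri_row N (3*j) + tri_row N (3*j+1) + tri_row N (3*j+2))"
proof -
  have "{a. tri a \<le> N} \<subseteq> {..<3 * J}"
  proof safe
    fix a assume "tri a \<le> N"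
    with assms have "tri a < tri (3 * J)" by simp
    then show "a < 3 * J"
      using strict_mono_less[OF strict_mono_tri] by blast
  qed
  then have "tri_sum N = (\<Sum>a<3 * J. tri_row N a)"
    unfolding tri_sum_def by (intro sum.mono_neutral_left) (auto intro: tri_row_eq_0)
  also have "\<dots> = (\<Sum>j<J. tri_row N (3*j) + tri_row N (3*j+1) + tri_row N (3*j+2))"
  proof (induction J)
    case (Suc J)
    have "3 * Suc J = Suc (Suc (Suc (3 * J)))" by simp
    then have "(\<Sum>a<3 * Suc J. tri_row N a) = (\<Sum>a<3 * J. tri_row N a) + (tri_row N (3*J) + tri_row N (3*J+1) + tri_row N (3*J+2))"
      by (simp only: sum.lessThan_Suc) (simp add: add_ac)
    then show ?case by (simp only: Suc.IH sum.lessThan_Suc)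
  qed simp
  finally show ?thesis .
qed

lemma sum_linear: "2 * (\<Sum>j<J. c - 3 * int j) = int J * (2 * c - 3 * int J + 3)"
  by (induction J) (auto simp: algebra_simps)

section \<open>Representations as sums of multiples of 3 and 5\<close>

definition count_3_5 :: "nat \<Rightarrow> nat" where
  "count_3_5 n = card {i. i \<le> n \<and> 3 dvd i \<and> 5 dvd n - i}"

text \<open>
  The least nonnegative multiple of 5 that is congruent to \<open>n\<close> modulo 3.
\<close>

definition first_mult_5 :: "int \<Rightarrow> int" where
  "first_mult_5 n = (if n mod 3 = 0 then 0 else if n mod 3 = 1 then 10 else 5)"

text \<open>
  In \<open>n = 3x + 5y\<close> the possible values of \<open>5y\<close> are \<open>s, s + 15, s + 30, \<dots>\<close> up to \<open>n\<close>, where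
  \<open>s = first_mult_5 n\<close>. If \<open>n < s\<close>, the bound is 0 because the quotient is rounded down to -1.
\<close>

lemma count_3_5_ge:
  "(int n - first_mult_5 (int n)) div 15 + 1 \<le> int (count_3_5 n)"
proof -
  define s where "s = nat (first_mult_5 (int n))"
  have s: "first_mult_5 (int n) = int s"
    by (simp add: s_def first_mult_5_def)
  have "s = (if n mod 3 = 0 then 0 else if n mod 3 = 1 then 10 else 5)"
  proof -
    have "int n mod 3 = int (n mod 3)" by (simp add: zmod_int)
    then show ?thesis by (simp add: s_def first_mult_5_def)
  qed
  moreover have "n mod 3 = 0 \<or> n mod 3 = 1 \<or> n mod 3 = 2" by linarith
  ultimately have "5 dvd s" "s mod 3 = n mod 3" "s < 15"
    by (auto split: if_splits)
  show ?thesis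
  proof (cases "s \<le> n")
    case False
    then have "(int n - int s) div 15 = -1"
      using \<open>s < 15\<close> by (intro int_div_pos_eq[of _ _ _ "int n - int s + 15"]) auto
    then show ?thesis by (simp add: s)
  next
    case True
    let ?m = "(n - s) div 15"
    have le: "s + 15 * j \<le> n" if "j \<le> ?m" for j
      using mult_le_mono2[OF that, of 15] times_div_less_eq_dividend[of 15 "n - s"] True by linarith
    have "(\<lambda>j. n - (s + 15 * j)) ` {..?m} \<subseteq> {i. i \<le> n \<and> 3 dvd i \<and> 5 dvd n - i}"
    proof safe
      fix j assume "j \<le> ?m"
      from le[OF this] have "s + 15 * j \<le> n" .
      then show "3 dvd n - (s + 15 * j)"
        using \<open>s mod 3 = n mod 3\<close> mod_eq_dvd_iff_nat[of "s + 15 * j" n 3]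
          mod_mult_self1[of s "5 * j" 3] by simp
      from \<open>s + 15 * j \<le> n\<close> have "n - (n - (s + 15 * j)) = s + 15 * j" by simp
      then show "5 dvd n - (n - (s + 15 * j))"
        using \<open>5 dvd s\<close> by simp
    qed simp
    moreover have "finite {i. i \<le> n \<and> 3 dvd i \<and> 5 dvd n - i}"
      by (rule finite_subset[of _ "{..n}"]) auto
    moreover have "inj_on (\<lambda>j. n - (s + 15 * j)) {..?m}"
    proof (rule inj_onI)
      fix i j assume "i \<in> {..?m}" "j \<in> {..?m}" "n - (s + 15 * i) = n - (s + 15 * j)"
      with le[of i] le[of j] show "i = j" by simp
    qed
    ultimately have "card {..?m} \<le> count_3_5 n"
      unfolding count_3_5_def by (intro card_inj_on_le)
    moreover have "(int n - int s) div 15 = int ?m"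
      using True by (simp add: zdiv_int of_nat_diff)
    ultimately show ?thesis by (simp add: s)
  qed
qed

text \<open>
  The quotient of the sharp bound has a numerator divisible by 3, so its remainder modulo 15 is
  at most 12.
\<close>

lemma count_3_5_linear:
  "int n - first_mult_5 (int n) + 3 \<le> 15 * int (count_3_5 n)"
proof -
  have "(int n - first_mult_5 (int n)) mod 3 = 0"
  proof -
    have "first_mult_5 (int n) mod 3 = int n mod 3"
      using pos_mod_bound[of 3 "int n"] pos_mod_sign[of 3 "int n"]
      by (auto simp: first_mult_5_def)
    then show ?thesis
      by (simp add: mod_eq_dvd_iff[symmetric] flip: dvd_eq_mod_eq_0)
  qed
  then obtain k where k: "int n - first_mult_5 (int n) = 3 * k"
    by auto
  have "(3 * k) div 15 = k div 5"
    using div_mult_mult1[of 3 k 5] by simp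
  then have "k div 5 + 1 \<le> int (count_3_5 n)"
    using count_3_5_ge[of n] unfolding k by simp
  moreover have "k - 4 \<le> 5 * (k div 5)"
    by linarith
  ultimately show ?thesis
    unfolding k by linarith
qed

section \<open>Lower bounds for the coefficients\<close>

text \<open>
  The coefficient \<open>G (N + 3)\<close>. Its three parts belong to \<open>\<psi>\<^sup>2 / ((1 + X)(1 - X\<^sup>3))\<close>,
  \<open>1 / (1 - X\<^sup>3)\<^sup>2\<close> and \<open>1 / ((1 - X\<^sup>3)(1 - X\<^sup>5))\<close>.
\<close>

definition shifted_coeff :: "nat \<Rightarrow> int" where
  "shifted_coeff N = tri_sum N - of_bool (3 dvd N) * (int (N div 3) + 1) + int (count_3_5 (Suc N))"

lemma shifted_coeff_mod_3_eq_0: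
  assumes "int N mod 3 = 0"
  shows "3 * shifted_coeff N = 3 * tri_sum N - int N - 3 + 3 * int (count_3_5 (Suc N))"
proof -
  have "3 dvd N"
    using assms by (metis dvd_eq_mod_eq_0 int_dvd_int_iff of_nat_numeral)
  then obtain m where "N = 3 * m" by auto
  then show ?thesis by (simp add: shifted_coeff_def)
qed

lemma shifted_coeff_mod_3_neq_0:
  assumes "int N mod 3 \<noteq> 0"
  shows "shifted_coeff N = tri_sum N + int (count_3_5 (Suc N))"
proof -
  have "\<not> 3 dvd N"
    using assms by (metis dvd_eq_mod_eq_0 int_dvd_int_iff of_nat_numeral)
  then show ?thesis by (simp add: shifted_coeff_def)
qed

lemma row_mod_0: "(int N - int (tri a)) mod 3 = 0 \<Longrightarrow> int (row_len N a) - 1 \<le> 2 * tri_row N a"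
  using row_bound[of "int N - int (tri a)" "row_len N a"] by (simp add: row_bound_def tri_row_def)

lemma row_mod_1: "(int N - int (tri a)) mod 3 = 1 \<Longrightarrow> - int (row_len N a) - 5 \<le> 6 * tri_row N a"
  using row_bound[of "int N - int (tri a)" "row_len N a"] by (simp add: row_bound_def tri_row_def)

lemma row_mod_2:
  assumes "(int N - int (tri a)) mod 3 = 2"
  shows "0 \<le> tri_row N a" "int (row_len N a) - 5 \<le> 6 * tri_row N a"
  using assms row_bound[of "int N - int (tri a)" "row_len N a"] by (simp_all add: row_bound_def tri_row_def)

lemma diff_mod_3:
  fixes x y :: int
  shows "x mod 3 = i \<Longrightarrow> y mod 3 = j \<Longrightarrow> (x - y) mod 3 = (i - j) mod 3"
  using mod_diff_eq[of x 3 y] by simp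

text \<open>
  The numerical comparison at the end of the estimate, for the residues 0, 1, 2 of \<open>N\<close> modulo 3.
  Here \<open>j\<close> is the number of blocks of three rows and \<open>r\<close> is the largest index with \<open>tri r \<le> N\<close>.
  After elimination of \<open>r\<close> all differences are quadratics in \<open>j\<close> with positive leading
  coefficient. They are nonnegative for \<open>r \<ge> 16\<close>; the second one fails at \<open>r = 15\<close>, \<open>j = 6\<close>.
\<close>

lemma block_count_inequalities:
  fixes j r :: int
  assumes "3 * j = r + 1 \<or> 3 * j = r + 2 \<or> 3 * j = r + 3" "16 \<le> r"
  shows "0 \<le> 15 * (j * (2 * (r - 1) - 3 * j + 3)) - 4 * ((r + 1) * (r + 2)) - 42"
    and "0 \<le> 5 * (j * (2 * (r - 13) - 3 * j + 3)) - 10 * r + 2 * (r * (r + 1)) - 64"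
    and "30 * j \<le> r * (r + 1) + 8"
proof -
  define s where "s = j * j"
  then have fold: "j * j = s" "j * (j * x) = s * x" for x
    by simp_all
  consider "r = 3 * j - 1" "6 * j \<le> s" "6 \<le> j" | "r = 3 * j - 2" "6 * j \<le> s" "6 \<le> j"
    | "r = 3 * j - 3" "7 * j \<le> s" "7 \<le> j"
  proof -
    have "r = 3 * j - 1 \<and> 6 \<le> j \<or> r = 3 * j - 2 \<and> 6 \<le> j \<or> r = 3 * j - 3 \<and> 7 \<le> j"
      using assms by linarith
    moreover have "c * j \<le> s" if "c \<le> j" "6 \<le> j" for c
      using that unfolding s_def by (intro mult_right_mono) auto
    ultimately show thesis
      using that by fastforce
  qed
  then have "0 \<le> 15 * (j * (2 * (r - 1) - 3 * j + 3)) - 4 * ((r + 1) * (r + 2)) - 42 \<and>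
    0 \<le> 5 * (j * (2 * (r - 13) - 3 * j + 3)) - 10 * r + 2 * (r * (r + 1)) - 64 \<and>
    30 * j \<le> r * (r + 1) + 8"
  proof cases
    case 1
    from 1(2,3) show ?thesis
      unfolding 1(1) by (simp add: algebra_simps fold)
  next
    case 2
    from 2(2,3) show ?thesis
      unfolding 2(1) by (simp add: algebra_simps fold)
  next
    case 3
    from 3(2,3) show ?thesis
      unfolding 3(1) by (simp add: algebra_simps fold)
  qed
  then show "0 \<le> 15 * (j * (2 * (r - 1) - 3 * j + 3)) - 4 * ((r + 1) * (r + 2)) - 42"
    and "0 \<le> 5 * (j * (2 * (r - 13) - 3 * j + 3)) - 10 * r + 2 * (r * (r + 1)) - 64"
    and "30 * j \<le> r * (r + 1) + 8"
    by blast+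
qed

text \<open>
  Let \<open>\<beta>\<^sub>a\<close> be the length of row \<open>a\<close>, so that \<open>\<beta>\<^sub>a \<ge> R + 1 - a\<close>. A block of three rows contributes at
  least \<open>R - 3i - 1\<close> if \<open>3\<close> divides \<open>N\<close>. If \<open>N \<equiv> 2\<close>, the mean parts \<open>\<beta>/6\<close> and \<open>-\<beta>/6\<close> of the
  first two rows nearly cancel with the right sign, and the block contributes at least -1. If \<open>N \<equiv> 1\<close>,
  only the middle row of a block has positive mean, so row 0 is split off and the blocks start at
  row 1: then the positive row is the longest of its block. Here \<open>136 = T\<^sub>1\<^sub>6\<close>, which forces
  \<open>R \<ge> 16\<close>.
\<close>

lemma shifted_coeff_nonneg_large:
  assumes N: "136 \<le> N"
  shows "0 \<le> shifted_coeff N"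
proof -
  obtain R where R: "tri R \<le> N" "N < tri (Suc R)"
    by (rule triangle_number_bounds)
  have "15 < R"
  proof (rule ccontr)
    assume "\<not> 15 < R"
    then have "tri (Suc R) \<le> tri 16"
      by (intro strict_mono_leD[OF strict_mono_tri]) simp
    with R N show False by (simp add: tri_def)
  qed
  \<comment> \<open>the least number of blocks that cover the rows \<open>0, \<dots>, R\<close>\<close>
  define J where "J = (R + 3) div 3"
  have J: "3 * J = R + 1 \<or> 3 * J = R + 2 \<or> 3 * J = R + 3"
    unfolding J_def by presburger
  define j r n where "j = int J" and "r = int R" and "n = int N"
  define p where "p = int (count_3_5 (Suc N))"
  have len: "r + 1 - int a \<le> int (row_len N a)" for a
    using row_len_ge[OF R(1)] by (simp add: r_def)
  have tri_J: "tri (Suc R) \<le> tri (3 * J)"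
    using J by (intro strict_mono_leD[OF strict_mono_tri]) linarith
  then have blocks: "tri_sum N = (\<Sum>i<J. tri_row N (3*i) + tri_row N (3*i+1) + tri_row N (3*i+2))"
    using R by (intro tri_sum_blocks) simp
  have p: "n + 4 - first_mult_5 (n + 1) \<le> 15 * p"
    using count_3_5_linear[of "Suc N"] by (simp add: n_def p_def add_ac)
  \<comment> \<open>the enclosure of \<open>N\<close> between consecutive triangular numbers, doubled to avoid division\<close>
  have n_ge: "r * (r + 1) \<le> 2 * n" and n_less: "2 * n < (r + 1) * (r + 2)"
    using R two_tri[of R] two_tri[of "Suc R"] by (simp_all add: r_def n_def algebra_simps)
  have "3 * j = r + 1 \<or> 3 * j = r + 2 \<or> 3 * j = r + 3" "16 \<le> r"
    using J \<open>15 < R\<close> by (auto simp: j_def r_def)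
  note ineqs = block_count_inequalities[OF this]
  consider "n mod 3 = 0" | "n mod 3 = 1" | "n mod 3 = 2"
    using pos_mod_bound[of 3 n] pos_mod_sign[of 3 n] by linarith
  then show ?thesis
  proof cases
    case 1
    have "r - 3 * int i - 1 \<le> tri_row N (3*i) + tri_row N (3*i+1) + tri_row N (3*i+2)" for i
    proof -
      have "int (row_len N (3*i)) - 1 \<le> 2 * tri_row N (3*i)"
        by (rule row_mod_0) (use diff_mod_3[OF 1 tri_mod_3(1)[of i]] in \<open>simp add: n_def\<close>)
      moreover have "0 \<le> tri_row N (3*i+1)"
        by (rule row_mod_2) (use diff_mod_3[OF 1 tri_mod_3(2)[of i]] in \<open>simp add: n_def\<close>)
      moreover have "int (row_len N (3*i+2)) - 1 \<le> 2 * tri_row N (3*i+2)"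
        by (rule row_mod_0) (use diff_mod_3[OF 1 tri_mod_3(3)[of i]] in \<open>simp add: n_def\<close>)
      ultimately show ?thesis
        using len[of "3*i"] len[of "3*i+2"] by simp
    qed
    then have "(\<Sum>i<J. (r - 1) - 3 * int i) \<le> tri_sum N"
      unfolding blocks by (intro sum_mono) (simp add: algebra_simps)
    then have H: "j * (2 * (r - 1) - 3 * j + 3) \<le> 2 * tri_sum N"
      using sum_linear[of "r - 1" J] by (simp add: j_def)
    have "n - 6 \<le> 15 * p"
      using p mod_add_eq[of n 3 1] 1 by (simp add: first_mult_5_def)
    moreover have "3 * shifted_coeff N = 3 * tri_sum N - n - 3 + 3 * p"
      using 1 shifted_coeff_mod_3_eq_0 unfolding n_def p_def by simp
    ultimately have "30 * shifted_coeff N \<ge> 15 * (2 * tri_sum N) - 4 * (2 * n) - 42"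
      by simp
    then show ?thesis
      using H n_less ineqs(1) by linarith
  next
    case 2
    have "r - 13 - 3 * int i \<le> 6 * (tri_row N (3*i+1) + tri_row N (3*i+2) + tri_row N (3*i+3))" for i
    proof -
      have "int (row_len N (3*i+1)) - 1 \<le> 2 * tri_row N (3*i+1)"
        by (rule row_mod_0) (use diff_mod_3[OF 2 tri_mod_3(2)[of i]] in \<open>simp add: n_def\<close>)
      moreover have "- int (row_len N (3*i+2)) - 5 \<le> 6 * tri_row N (3*i+2)"
        by (rule row_mod_1) (use diff_mod_3[OF 2 tri_mod_3(3)[of i]] in \<open>simp add: n_def\<close>)
      moreover have "- int (row_len N (3*i+3)) - 5 \<le> 6 * tri_row N (3*i+3)"
        by (rule row_mod_1) (use diff_mod_3[OF 2 tri_mod_3(1)[of "Suc i"]] in \<open>simp add: n_def add.commute[of 3 "3 * i"]\<close>)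
      ultimately show ?thesis
        using len[of "3*i+1"] row_len_antimono[of "3*i+1" "3*i+2" N] row_len_antimono[of "3*i+1" "3*i+3" N] by simp
    qed
    then have S: "(\<Sum>i<J. (r - 13) - 3 * int i) \<le> (\<Sum>i<J. 6 * (tri_row N (3*i+1) + tri_row N (3*i+2) + tri_row N (3*i+3)))"
      by (intro sum_mono) 
    \<comment> \<open>the shift of the blocks by one row costs row 0 and adds row \<open>3 J\<close>, which is empty\<close>
    have "(\<Sum>i<J. tri_row N (3*i+1) + tri_row N (3*i+2) + tri_row N (3*i+3)) = tri_sum N - tri_row N 0"
    proof -
      have "(\<Sum>i<J. tri_row N (3*i+1) + tri_row N (3*i+2) + tri_row N (3*i+3))
          = (\<Sum>i<J. (tri_row N (3*i) + tri_row N (3*i+1) + tri_row N (3*i+2)) + (tri_row N (3 * Suc i) - tri_row N (3*i)))"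
        by (intro sum.cong) (simp_all add: add_ac)
      also have "\<dots> = tri_sum N + (tri_row N (3 * J) - tri_row N 0)"
        unfolding sum.distrib blocks using sum_lessThan_telescope[of "\<lambda>i. tri_row N (3*i)" J] by simp
      also have "tri_row N (3 * J) = 0"
        using R tri_J by (intro tri_row_eq_0) simp
      finally show ?thesis by simp
    qed
    then have "6 * tri_row N 0 + (\<Sum>i<J. (r - 13) - 3 * int i) \<le> 6 * tri_sum N"
      using S unfolding sum_distrib_left[symmetric] by simp
    moreover have "- (r + 1) - 5 \<le> 6 * tri_row N 0"
      using row_mod_1[of N 0] row_len_0[OF R(2)] 2 by (simp add: n_def r_def tri_def)
    ultimately have H: "j * (2 * (r - 13) - 3 * j + 3) - 2 * r - 12 \<le> 12 * tri_sum N"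
      using sum_linear[of "r - 13" J] by (simp add: j_def)
    have "n - 1 \<le> 15 * p"
      using p mod_add_eq[of n 3 1] 2 by (simp add: first_mult_5_def)
    moreover have "shifted_coeff N = tri_sum N + p"
      using 2 shifted_coeff_mod_3_neq_0 unfolding n_def p_def by simp
    ultimately have "60 * shifted_coeff N \<ge> 5 * (12 * tri_sum N) + 2 * (2 * n) - 4"
      by simp
    then show ?thesis
      using H n_ge ineqs(2) by linarith
  next
    case 3
    \<comment> \<open>the estimates give \<open>-10/6\<close>, and the left-hand side is an integer\<close>
    have "-1 \<le> tri_row N (3*i) + tri_row N (3*i+1) + tri_row N (3*i+2)" for i
    proof -
      have "int (row_len N (3*i)) - 5 \<le> 6 * tri_row N (3*i)"
        by (rule row_mod_2) (use diff_mod_3[OF 3 tri_mod_3(1)[of i]] in \<open>simp add: n_def\<close>)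
      moreover have "- int (row_len N (3*i+1)) - 5 \<le> 6 * tri_row N (3*i+1)"
        by (rule row_mod_1) (use diff_mod_3[OF 3 tri_mod_3(2)[of i]] in \<open>simp add: n_def\<close>)
      moreover have "0 \<le> tri_row N (3*i+2)"
        by (rule row_mod_2) (use diff_mod_3[OF 3 tri_mod_3(3)[of i]] in \<open>simp add: n_def\<close>)
      ultimately show ?thesis
        using row_len_antimono[of "3*i" "3*i+1" N] by simp
    qed
    then have "(\<Sum>i<J. -1) \<le> tri_sum N"
      unfolding blocks by (intro sum_mono)
    then have H: "- j \<le> tri_sum N"
      by (simp add: j_def)
    have "n + 4 \<le> 15 * p"
      using p mod_add_eq[of n 3 1] 3 by (simp add: first_mult_5_def)
    moreover have "shifted_coeff N = tri_sum N + p"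
      using 3 shifted_coeff_mod_3_neq_0 unfolding n_def p_def by simp
    ultimately have "30 * shifted_coeff N \<ge> 30 * tri_sum N + 2 * n + 8"
      by simp
    then show ?thesis
      using H n_ge ineqs(3) by linarith
  qed
qed

text \<open>
  The triangular numbers below 136. With this list, membership in the lattice region
  is decided by a filter, and the remaining coefficients become computable.
\<close>

definition tri_list :: "int list" where
  "tri_list = [0,1,3,6,10,15,21,28,36,45,55,66,78,91,105,120]"

definition row_check :: "int \<Rightarrow> int" where
  "row_check m = (\<Sum>t\<leftarrow>filter (\<lambda>t. t \<le> m) tri_list. hexa (m - t))"

text \<open>
  Nonnegativity of \<open>shifted_coeff n\<close>, with the number of representations replaced by its lower
  bound \<open>count_3_5_ge\<close>.
\<close>

definition small_check :: "int \<Rightarrow> bool" where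
  "small_check n \<longleftrightarrow>
     of_bool (n mod 3 = 0) * (n div 3 + 1)
     \<le> (\<Sum>t\<leftarrow>filter (\<lambda>t. t \<le> n) tri_list. row_check (n - t))
       + ((n + 1 - first_mult_5 (n + 1)) div 15 + 1)"

lemma small_check: "list_all small_check [0..135]"
  by code_simp

lemma sum_list_triangular:
  assumes "m < 136"
  shows "(\<Sum>t\<leftarrow>filter (\<lambda>t. t \<le> int m) tri_list. f t)
       = (\<Sum>a | tri a \<le> m. f (int (tri a)))"
proof -
  have eq: "tri_list = map (\<lambda>a. int (tri a)) [0..<16]"
    by (simp add: tri_list_def tri_def upt_rec)
  have "(\<Sum>t\<leftarrow>filter (\<lambda>t. t \<le> int m) tri_list. f t)
      = (\<Sum>a\<leftarrow>filter (\<lambda>a. tri a \<le> m) [0..<16]. f (int (tri a)))"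
    unfolding eq filter_map map_map o_def by simp
  also have "\<dots> = (\<Sum>a\<in>set (filter (\<lambda>a. tri a \<le> m) [0..<16]). f (int (tri a)))"
    by (rule sum_list_distinct_conv_sum_set) simp
  also have "set (filter (\<lambda>a. tri a \<le> m) [0..<16]) = {a. tri a \<le> m}"
  proof -
    have "a < 16" if "tri a \<le> m" for a
    proof -
      have "tri a < tri 16"
        using that assms by (simp add: tri_def[of 16])
      then show ?thesis
        using strict_mono_less[OF strict_mono_tri] by blast
    qed
    then show ?thesis by auto
  qed
  finally show ?thesis .
qed

lemma shifted_coeff_nonneg: "0 \<le> shifted_coeff N"
proof (cases "136 \<le> N")
  case False
  have row: "row_check (int N - int (tri a)) = tri_row N a" if "tri a \<le> N" for a
  proof -
    have "row_check (int (N - tri a)) = (\<Sum>b | tri b \<le> N - tri a. hexa (int (N - tri a) - int (tri b)))"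
      unfolding row_check_def using False by (intro sum_list_triangular) simp
    also have "\<dots> = tri_row N a"
      unfolding tri_row_altdef[OF that] by (intro sum.cong) (simp_all flip: of_nat_diff)
    finally show ?thesis using that by (simp add: of_nat_diff)
  qed
  have "(\<Sum>t\<leftarrow>filter (\<lambda>t. t \<le> int N) tri_list. row_check (int N - t))
      = (\<Sum>a | tri a \<le> N. row_check (int N - int (tri a)))"
    using False by (intro sum_list_triangular) simp
  also have "\<dots> = tri_sum N"
    unfolding tri_sum_def using row by (intro sum.cong) auto
  finally have "small_check (int N) \<longleftrightarrow> of_bool (int N mod 3 = 0) * (int N div 3 + 1)
      \<le> tri_sum N + ((int N + 1 - first_mult_5 (int N + 1)) div 15 + 1)"
    by (simp only: small_check_def)
  moreover have "small_check (int N)"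
    using small_check False by (auto simp: list_all_iff)
  moreover have "(int N + 1 - first_mult_5 (int N + 1)) div 15 + 1 \<le> int (count_3_5 (Suc N))"
    using count_3_5_ge[of "Suc N"] by (simp add: add.commute)
  moreover have "int N mod 3 = 0 \<longleftrightarrow> 3 dvd N"
    by (metis dvd_eq_mod_eq_0 int_dvd_int_iff of_nat_numeral)
  moreover have "int (N div 3) = int N div 3"
    by (simp add: zdiv_int)
  ultimately show ?thesis
    unfolding shifted_coeff_def by simp
qed (rule shifted_coeff_nonneg_large)

section \<open>Nonnegativity\<close>

theorem corollary2p9:
  fixes G :: "nat \<Rightarrow> complex"
  assumes "\<And>q :: complex. norm q < 1 \<Longrightarrow> (\<lambda>n. G n * q ^ n) sums G_fun q"
  shows "\<forall>n. G n \<in> \<real>\<^sub>\<ge>\<^sub>0"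
proof
  fix n
  define f :: "complex \<Rightarrow> complex" where "f q = (\<Sum>s. q ^ tri s)" for q
  have f: "gauss_quot q \<longlonglongrightarrow> f q \<and> (\<lambda>s. q ^ tri s) sums f q" if q: "norm q < 1" for q
  proof -
    obtain L where L: "gauss_quot q \<longlonglongrightarrow> L"
      using gauss_quot_convergent[OF q] by blast
    from theta_sums[OF q this] have "(\<lambda>s. q ^ tri s) sums L" .
    moreover from this have "f q = L"
      unfolding f_def by (rule sums_unique[symmetric])
    ultimately show ?thesis using L by simp
  qed
  have series: "Abs_fps G = fps_X ^ 3 * (theta_fps * (theta_fps * Abs_fps (\<lambda>n. of_int (hexa (int n)))))
      - fps_X ^ 3 * (geo 3 * geo 3) + fps_X\<^sup>2 * (geo 3 * geo 5)"
  proof (rule power_series_fps_identity)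
    show "f has_fps_expansion theta_fps"
      using f by (intro theta_has_fps_expansion) blast
    show "(1 - q ^ 3) * G_fun q = q ^ 3 * (f q)\<^sup>2 / (1 + q) - q ^ 3 / (1 - q ^ 3) + q\<^sup>2 / (1 - q ^ 5)"
      if "norm q < 1" for q
      using G_fun_closed_form[OF that] f[OF that] by blast
  qed (rule assms)
  have nth: "G n = fps_nth (fps_X ^ 3 * (theta_fps * (theta_fps * Abs_fps (\<lambda>n. of_int (hexa (int n)))))
      - fps_X ^ 3 * (geo 3 * geo 3) + fps_X\<^sup>2 * (geo 3 * geo 5)) n"
    using arg_cong[OF series, of "\<lambda>F. fps_nth F n"] by simp
  show "G n \<in> \<real>\<^sub>\<ge>\<^sub>0"
  proof (cases "3 \<le> n")
    case True
    then obtain N where N: "n = N + 3"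
      by (metis add.commute le_Suc_ex)
    have "fps_nth (theta_fps * (theta_fps * Abs_fps (\<lambda>n. of_int (hexa (int n))))) N = of_int (tri_sum N)"
      unfolding theta_fps_mult_nth tri_sum_def of_int_sum
      by (intro sum.cong) (simp_all add: tri_row_altdef)
    moreover have "fps_nth (geo 3 * geo 3) N = of_int (of_bool (3 dvd N) * (int (N div 3) + 1))"
      by (simp add: geo_mult_self)
    moreover have "fps_nth (geo 3 * geo 5) (Suc N) = of_int (int (count_3_5 (Suc N)))"
      by (simp add: geo_mult_geo_nth count_3_5_def)
    ultimately have "G n = of_int (shifted_coeff N)"
      unfolding nth shifted_coeff_def unfolding N by (simp add: fps_X_power_mult_nth)
    then show ?thesis
      using shifted_coeff_nonneg[of N] zero_le_imp_eq_int[of "shifted_coeff N"] by auto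
  next
    case False
    then have "G n = (if n < 2 then 0 else fps_nth (geo 3 * geo 5) (n - 2))"
      unfolding nth by (simp add: fps_X_power_mult_nth)
    then show ?thesis
      by (simp add: geo_mult_geo_nth)
  qed
qed

end
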